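(* Let $d \ge 2$, let $a \in \mathbb{R}^d$ with $a \neq 0$, let $\sigma_X^2, \sigma_Y^2 > 0$, and let $\mathcal{L}_1, \mathcal{L}_2$ be cdfs on $\mathbb{R}$, all known. For unknown $\theta \in \mathbb{R}^d$, let $X|\theta \sim MMN_d(\theta, a, \sigma_X^2 I_d, \mathcal{L}_1)$ and $Y|\theta \sim MMN_d(\theta, a, \sigma_Y^2 I_d, \mathcal{L}_2)$ be independently distributed. Let $H = \begin{pmatrix} h_1^{\top} \\ H_2 \end{pmatrix}$ be a $d \times d$ orthogonal matrix with $h_1 = a/\|a\|$, and set $$X' = HX = \begin{pmatrix} X_1' \\ X_{(2)}' \end{pmatrix}, \quad Y' = HY = \begin{pmatrix} Y_1' \\ Y_{(2)}' \end{pmatrix}, \quad \zeta = H\theta = \begin{pmatrix} \zeta_1 \\ \zeta_{(2)} \end{pmatrix},$$ with $X_1', Y_1', \zeta_1 \in \mathbb{R}$ and $X_{(2)}', Y_{(2)}', \zeta_{(2)} \in \mathbb{R}^{d-1}$. Consider prior densities (with respect to Lebesgue measure on $\mathbb{R}^d$, possibly improper) of the form $\pi(\theta) = \pi_0(\zeta_{(2)}) = \pi_0(H_2\theta)$. (a) The Bayes predictive density for $Y$ is given by $$\hat{q}_\pi(y;X) = \hat{q}'_\pi(Hy; X'), \quad y \in \mathbb{R}^d,$$ with $\hat{q}'_\pi(\cdot;X')$ the Bayes predictive density for $Y'$ based on $X'$, given by $$\hat{q}'_\pi(y';X') = \hat{q}_U(y_1';X_1') \times \hat{q}'_{\pi_0}(y_{(2)}';X_{(2)}'),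 \quad y'=(y_1',y_{(2)}') \in \mathbb{R}\times\mathbb{R}^{d-1},$$ where: (i) $\hat{q}_U(\cdot;X_1')$ is the minimum risk equivariant (MRE) predictive density of $Y_1' \sim MMN_1(\zeta_1, \|a\|, \sigma_Y^2, \mathcal{L}_2)$ based on $X_1' \sim MMN_1(\zeta_1, \|a\|, \sigma_X^2, \mathcal{L}_1)$; and (ii) $\hat{q}'_{\pi_0}(\cdot;X_{(2)}')$ is the Bayes predictive density for $Y_{(2)}' \sim N_{d-1}(\zeta_{(2)}, \sigma_Y^2 I_{d-1})$ based on $X_{(2)}' \sim N_{d-1}(\zeta_{(2)}, \sigma_X^2 I_{d-1})$ for the prior density $\pi_0(\zeta_{(2)})$ for $\zeta_{(2)}$. (b) If $d \ge 4$, then $\hat{q}_\pi$ dominates, under Kullback-Leibler risk, the MRE predictive density $\hat{q}_U(\cdot;X)$ of $Y$ based on $X$, and is therefore minimax, if and only if $\hat{q}'_{\pi_0}(\cdot;X_{(2)}')$ dominates the MRE predictive density for $Y_{(2)}'$ based on $X_{(2)}'$, which is the $N_{d-1}(X_{(2)}', (\sigma_X^2+\sigma_Y^2) I_{d-1})$ density.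
   Context: A random vector $X \in \mathbb{R}^d$ has a mean-mixture of normal distributions, written $X \sim MMN_d(\theta, a, \Sigma, \mathcal{L})$, if $X|V=v \sim N_d(\theta + v a, \Sigma)$ with $V \sim \mathcal{L}$, where $\theta\in\mathbb{R}^d$ is a location parameter, $a \in \mathbb{R}^d$ a perturbation vector, $\Sigma$ a positive definite matrix, and $V$ a scalar random variable with cdf $\mathcal{L}$. Let $p(\cdot|\theta)$, $q(\cdot|\theta)$ denote the conditional densities of the observable $X$ and of $Y$ given $\theta$. For a prior density $\pi$, the Bayes predictive density is $\hat{q}_\pi(y;x) = \int q(y|\theta)\,\pi(\theta|x)\,d\theta$, where $\pi(\theta|x) = p(x|\theta)\pi(\theta)/\int p(x|t)\pi(t)\,dt$ is the posterior density (it is understood that the normalizing integral is positive and finite). The MRE predictive density $\hat{q}_U$ (under changes of location, for Kullback-Leibler loss) is the Bayes predictive density for the uniform prior $\pi_U(\theta)=1$. For $X|\theta \sim MMN_d(\theta, a, \Sigma_X, \mathcal{L}_1)$ and $Y|\theta \sim MMN_d(\theta, a, \Sigma_Y, \mathcal{L}_2)$ it is the $MMN_d(X, a, \Sigma_X+\Sigma_Y, \mathcal{L}_3)$ density, with $\mathcal{L}_3$ the cdf of $V_2-V_1$ for independent $V_1\sim\mathcal{L}_1$, $V_2\sim\mathcal{L}_2$. The Kullback-Leibler risk of a predictive density estimator $\hat{q}(\cdot;X)$ is $R_{KL}(\theta,\hat{q}) = \int \left\{ \int q(y|\theta) \log \frac{q(y|\theta)}{\hat{q}(y;x)}\, dy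 \right\} p(x|\theta)\, dx$. One predictive density dominates another if its risk is less than or equal to that of the other for all parameter values, with strict inequality for at least one. A predictive density estimator is minimax if it minimizes $\sup_\theta R_{KL}(\theta,\cdot)$ among all predictive density estimators.
   Formalization: In (b), the "if" direction is stated under the added hypothesis that the MRE density's Kullback-Leibler risk is finite; it fails otherwise, e.g. when L_1 is so heavy-tailed that both risks are infinite. The "only if" direction and minimaxity are stated without it. *)

theory Defs
  imports "HOL-Probability.Probability"
begin

text \<open>
  The space \<open>\<real>\<^sup>d\<close> with \<open>d \<ge> 2\<close> is \<open>real ^ 'm option\<close>, so that \<open>d = CARD('m) + 1\<close>; the index
  \<open>None\<close> is the first coordinate and the indices \<open>Some i\<close> are the other \<open>d - 1 \<ge> 1\<close> ones.
  The one-dimensional factor is \<open>real ^ 1\<close>, so that all models below are instances of the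
  same definitions.
\<close>

definition fst_coord :: "real ^ 'm::finite option \<Rightarrow> real ^ 1" where
  "fst_coord x = vec (x $ None)"

definition rest_coords :: "real ^ 'm::finite option \<Rightarrow> real ^ 'm" where
  "rest_coords x = (\<chi> i. x $ Some i)"


text \<open>
  Conditional densities have the observation as first and the parameter as second argument:
  \<open>p x \<theta>\<close> stands for \<open>p(x|\<theta>)\<close>. Predictive densities have the predicted value first and the
  observed value second: \<open>qhat y x\<close> stands for \<open>qhat(y; x)\<close>.
\<close>

definition mvn_pdf :: "real ^ 'n ^ 'n \<Rightarrow> real ^ 'n \<Rightarrow> real ^ 'n::finite \<Rightarrow> real" where
  "mvn_pdf \<Sigma> x \<mu> =
     exp (- ((x - \<mu>) \<bullet> (matrix_inv \<Sigma> *v (x - \<mu>))) / 2) / sqrt ((2 * pi) ^ CARD('n) * det \<Sigma>)"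

definition mvn :: "real ^ 'n \<Rightarrow> real ^ 'n ^ 'n \<Rightarrow> (real ^ 'n::finite) measure" where
  "mvn \<mu> \<Sigma> = density lborel (\<lambda>x. ennreal (mvn_pdf \<Sigma> x \<mu>))"

text \<open>
  The law with cdf \<open>\<L>\<close> is represented by the probability measure \<open>L\<close> on the real line.
  \<open>MMN \<theta> a \<Sigma> L\<close> is the law obtained by first drawing \<open>v\<close> from \<open>L\<close> and then from
  \<open>mvn (\<theta> + v a) \<Sigma>\<close>; \<open>mmn_pdf\<close> is its Lebesgue density (lemma \<open>MMN_eq_density\<close>).
\<close>

definition MMN :: "real ^ 'n \<Rightarrow> real ^ 'n \<Rightarrow> real ^ 'n ^ 'n \<Rightarrow> real measure
    \<Rightarrow> (real ^ 'n::finite) measure" where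
  "MMN \<theta> a \<Sigma> L = L \<bind> (\<lambda>v. mvn (\<theta> + v *\<^sub>R a) \<Sigma>)"

definition mmn_pdf :: "real ^ 'n \<Rightarrow> real ^ 'n ^ 'n \<Rightarrow> real measure
    \<Rightarrow> real ^ 'n \<Rightarrow> real ^ 'n::finite \<Rightarrow> real" where
  "mmn_pdf a \<Sigma> L x \<theta> = (\<integral>v. mvn_pdf \<Sigma> x (\<theta> + v *\<^sub>R a) \<partial>L)"

lemma mvn_pdf_mat:
  fixes x \<mu> :: "real ^ 'n::finite"
  assumes "0 < s"
  shows "mvn_pdf (mat s) x \<mu> = exp (- (norm (x - \<mu>))\<^sup>2 / (2 * s)) / sqrt ((2 * pi * s) ^ CARD('n))"
proof -
  have prod: "mat u ** mat w = (mat (u * w) :: real ^ 'n ^ 'n)" for u w :: real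
    by (auto simp: matrix_matrix_mult_def mat_def vec_eq_iff if_distrib cong: if_cong intro!: sum.neutral)
  have "\<exists>B :: real ^ 'n ^ 'n. mat s ** B = mat 1 \<and> B ** mat s = mat 1"
    using assms by (intro exI[of _ "mat (1 / s)"]) (simp add: prod)
  then have "matrix_inv (mat s) ** mat s = (mat 1 :: real ^ 'n ^ 'n)"
    unfolding matrix_inv_def by (rule someI2_ex) auto
  then have "matrix_inv (mat s) ** (mat s ** mat (1 / s)) = (mat (1 / s) :: real ^ 'n ^ 'n)"
    by (simp add: matrix_mul_assoc)
  then have inv: "matrix_inv (mat s) = (mat (1 / s) :: real ^ 'n ^ 'n)"
    using assms by (simp add: prod)
  have vec: "(mat u :: real ^ 'n ^ 'n) *v y = u *\<^sub>R y" for u and y :: "real ^ 'n"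
    by (simp add: matrix_vector_mult_def mat_def vec_eq_iff if_distribR if_distrib cong: if_cong)
  have det: "det (mat s :: real ^ 'n ^ 'n) = s ^ CARD('n)"
    by (subst det_diagonal) (simp_all add: mat_def)
  show ?thesis
    by (simp add: mvn_pdf_def inv vec det power_mult_distrib power2_norm_eq_inner)
qed

lemma borel_measurable_mvn_pdf_mat:
  fixes f g :: "'b \<Rightarrow> real ^ 'n::finite"
  assumes "0 < s" and [measurable]: "f \<in> borel_measurable N" "g \<in> borel_measurable N"
  shows "(\<lambda>z. mvn_pdf (mat s) (f z) (g z)) \<in> borel_measurable N"
  by (simp add: mvn_pdf_mat[OF assms(1)])

lemma prob_space_mvn_mat:
  fixes \<mu> :: "real ^ 'n::finite"
  assumes "0 < s"
  shows "prob_space (mvn \<mu> (mat s))"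
proof -
  have eq: "mvn_pdf (mat s) x \<mu> = (\<Prod>b\<in>Basis. normal_density (\<mu> \<bullet> b) (sqrt s) (x \<bullet> b))" for x
  proof -
    have "(\<Prod>b\<in>Basis. normal_density (\<mu> \<bullet> b) (sqrt s) (x \<bullet> b)) =
        (\<Prod>b\<in>(Basis::(real^'n) set). 1 / sqrt (2 * pi * s)) * exp (\<Sum>b\<in>Basis. - (((x - \<mu>) \<bullet> b)\<^sup>2 / (2 * s)))"
      using assms by (simp add: normal_density_def prod.distrib prod_dividef exp_sum inner_diff_left power_one_over)
    also have "(\<Sum>b\<in>Basis. - (((x - \<mu>) \<bullet> b)\<^sup>2 / (2 * s))) = - (norm (x - \<mu>))\<^sup>2 / (2 * s)"
      unfolding power2_norm_eq_inner euclidean_inner[of "x - \<mu>" "x - \<mu>"]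
      by (simp add: sum_negf sum_divide_distrib power2_eq_square)
    finally show ?thesis
      using assms by (simp add: mvn_pdf_mat power_divide real_sqrt_power)
  qed
  have "(\<integral>\<^sup>+x. ennreal (mvn_pdf (mat s) x \<mu>) \<partial>lborel) =
      (\<integral>\<^sup>+x. (\<Prod>b\<in>Basis. ennreal (normal_density (\<mu> \<bullet> b) (sqrt s) (x \<bullet> b))) \<partial>lborel)"
    by (simp add: eq prod_ennreal)
  also have "\<dots> = (\<Prod>b\<in>Basis. \<integral>\<^sup>+x. ennreal (normal_density (\<mu> \<bullet> b) (sqrt s) x) \<partial>lborel)"
    by (rule nn_integral_lborel_prod) auto
  also have "\<dots> = 1"
    using prob_space.emeasure_space_1[OF prob_space_normal_density, of "sqrt s"] assms
    by (simp add: emeasure_density)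
  finally show ?thesis
    using borel_measurable_mvn_pdf_mat[OF assms, of "\<lambda>x. x" lborel "\<lambda>_. \<mu>"]
    by (auto intro!: prob_spaceI simp: mvn_def emeasure_density)
qed

lemma MMN_eq_density:
  fixes \<theta> a :: "real ^ 'n::finite"
  assumes "0 < s" and "real_distribution L"
  shows "MMN \<theta> a (mat s) L = density lborel (\<lambda>x. ennreal (mmn_pdf a (mat s) L x \<theta>))"
proof -
  interpret L: real_distribution L by fact
  note [measurable] = borel_measurable_mvn_pdf_mat[OF assms(1)]
  have nonneg: "0 \<le> mvn_pdf (mat s) x \<mu>" for x \<mu> :: "real ^ 'n"
    using assms(1) by (simp add: mvn_pdf_mat)
  have bound: "mvn_pdf (mat s) x \<mu> \<le> 1 / sqrt ((2 * pi * s) ^ CARD('n))" for x \<mu> :: "real ^ 'n"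
    using assms(1) by (simp add: mvn_pdf_mat divide_right_mono)
  have int: "ennreal (mmn_pdf a (mat s) L x \<theta>) = (\<integral>\<^sup>+v. ennreal (mvn_pdf (mat s) x (\<theta> + v *\<^sub>R a)) \<partial>L)" for x
    unfolding mmn_pdf_def
    by (intro nn_integral_eq_integral[symmetric]
          L.integrable_const_bound[of _ "1 / sqrt ((2 * pi * s) ^ CARD('n))"])
       (auto simp: nonneg bound)
  have meas: "(\<lambda>x. mmn_pdf a (mat s) L x \<theta>) \<in> borel_measurable borel"
    unfolding mmn_pdf_def by measurable
  have em: "emeasure (mvn \<mu> (mat s)) A = (\<integral>\<^sup>+x. ennreal (mvn_pdf (mat s) x \<mu>) * indicator A x \<partial>lborel)"
    if "A \<in> sets borel" for A and \<mu> :: "real ^ 'n"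
    using that unfolding mvn_def by (subst emeasure_density) auto
  have kernel: "(\<lambda>v. mvn (\<theta> + v *\<^sub>R a) (mat s)) \<in> measurable L (subprob_algebra borel)"
  proof (rule measurable_subprob_algebra)
    show "subprob_space (mvn (\<theta> + v *\<^sub>R a) (mat s))" for v
      by (intro prob_space_imp_subprob_space prob_space_mvn_mat assms)
    show "sets (mvn (\<theta> + v *\<^sub>R a) (mat s)) = sets borel" for v by (simp add: mvn_def)
    show "(\<lambda>v. emeasure (mvn (\<theta> + v *\<^sub>R a) (mat s)) A) \<in> borel_measurable L" 
      if [measurable]: "A \<in> sets borel" for A
      unfolding em[OF that] by measurable
  qed
  show ?thesis
  proof (rule measure_eqI)
    have s: "sets (MMN \<theta> a (mat s) L) = sets borel"
      unfolding MMN_def using kernel by (intro sets_bind) (auto simp: mvn_def)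
    then show "sets (MMN \<theta> a (mat s) L) =
        sets (density lborel (\<lambda>x. ennreal (mmn_pdf a (mat s) L x \<theta>)))" by simp
    fix A assume "A \<in> sets (MMN \<theta> a (mat s) L)"
    then have A[measurable]: "A \<in> sets borel" by (simp add: s)
    interpret P: pair_sigma_finite L "lborel :: (real ^ 'n) measure" ..
    have "emeasure (MMN \<theta> a (mat s) L) A =
        (\<integral>\<^sup>+v. \<integral>\<^sup>+x. ennreal (mvn_pdf (mat s) x (\<theta> + v *\<^sub>R a)) * indicator A x \<partial>lborel \<partial>L)"
      unfolding MMN_def using kernel A
      by (subst emeasure_bind[where N = borel]) (auto simp: em)
    also have "\<dots> = (\<integral>\<^sup>+x. \<integral>\<^sup>+v. ennreal (mvn_pdf (mat s) x (\<theta> + v *\<^sub>R a)) * indicator A x \<partial>L \<partial>lborel)"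
      by (rule P.Fubini'[symmetric]) measurable
    also have "\<dots> = (\<integral>\<^sup>+x. ennreal (mmn_pdf a (mat s) L x \<theta>) * indicator A x \<partial>lborel)"
      by (simp add: int nn_integral_multc)
    finally show "emeasure (MMN \<theta> a (mat s) L) A =
        emeasure (density lborel (\<lambda>x. ennreal (mmn_pdf a (mat s) L x \<theta>))) A"
      using meas by (simp add: emeasure_density)
  qed
qed


definition indep_with_laws :: "'w measure \<Rightarrow> ('w \<Rightarrow> 'a::topological_space) \<Rightarrow> ('w \<Rightarrow> 'a)
    \<Rightarrow> 'a measure \<Rightarrow> 'a measure \<Rightarrow> bool" where
  "indep_with_laws M X Y P Q \<longleftrightarrow>
     prob_space M \<and> prob_space.indep_var M borel X borel Y \<and>
     distr M borel X = P \<and> distr M borel Y = Q"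


definition posterior_pdf :: "('x \<Rightarrow> 't::euclidean_space \<Rightarrow> real) \<Rightarrow> ('t \<Rightarrow> real) \<Rightarrow> 't \<Rightarrow> 'x \<Rightarrow> real" where
  "posterior_pdf p \<pi> \<theta> x = p x \<theta> * \<pi> \<theta> / (\<integral>t. p x t * \<pi> t \<partial>lborel)"

definition bayes_predictive :: "('x \<Rightarrow> 't::euclidean_space \<Rightarrow> real) \<Rightarrow> ('y \<Rightarrow> 't \<Rightarrow> real)
    \<Rightarrow> ('t \<Rightarrow> real) \<Rightarrow> 'y \<Rightarrow> 'x \<Rightarrow> real" where
  "bayes_predictive p q \<pi> y x = (\<integral>\<theta>. q y \<theta> * posterior_pdf p \<pi> \<theta> x \<partial>lborel)"

definition posterior_well_defined ::
    "('x \<Rightarrow> 't::euclidean_space \<Rightarrow> real) \<Rightarrow> ('t \<Rightarrow> real) \<Rightarrow> bool" where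
  "posterior_well_defined p \<pi> \<longleftrightarrow>
     (\<forall>x. 0 < (\<integral>\<^sup>+t. ennreal (p x t * \<pi> t) \<partial>lborel) \<and>
          (\<integral>\<^sup>+t. ennreal (p x t * \<pi> t) \<partial>lborel) < \<infinity>)"

definition mre_predictive :: "('x \<Rightarrow> 't::euclidean_space \<Rightarrow> real) \<Rightarrow> ('y \<Rightarrow> 't \<Rightarrow> real)
    \<Rightarrow> 'y \<Rightarrow> 'x \<Rightarrow> real" where
  "mre_predictive p q = bayes_predictive p q (\<lambda>_. 1)"


text \<open>
  Kullback-Leibler risks can be infinite, so they are computed in the extended reals; the
  Bochner integral would silently return 0 for a divergent integral. The integrand
  \<open>u log (u / v)\<close> is 0 for \<open>u = 0\<close> and \<open>\<infinity>\<close> for \<open>u > 0 = v\<close>.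
\<close>

definition ereal_integral :: "'a measure \<Rightarrow> ('a \<Rightarrow> ereal) \<Rightarrow> ereal" where
  "ereal_integral M f =
     enn2ereal (\<integral>\<^sup>+x. e2ennreal (f x) \<partial>M) - enn2ereal (\<integral>\<^sup>+x. e2ennreal (- f x) \<partial>M)"

definition kl_integrand :: "real \<Rightarrow> real \<Rightarrow> ereal" where
  "kl_integrand u v = (if u = 0 then 0 else if v = 0 then \<infinity> else ereal (u * ln (u / v)))"

definition kl_loss :: "('y::euclidean_space \<Rightarrow> 't \<Rightarrow> real) \<Rightarrow> ('y \<Rightarrow> 'x \<Rightarrow> real)
    \<Rightarrow> 't \<Rightarrow> 'x \<Rightarrow> ereal" where
  "kl_loss q qhat \<theta> x = ereal_integral lborel (\<lambda>y. kl_integrand (q y \<theta>) (qhat y x))"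

definition kl_risk :: "('x::euclidean_space \<Rightarrow> 't \<Rightarrow> real) \<Rightarrow> ('y::euclidean_space \<Rightarrow> 't \<Rightarrow> real)
    \<Rightarrow> 't \<Rightarrow> ('y \<Rightarrow> 'x \<Rightarrow> real) \<Rightarrow> ereal" where
  "kl_risk p q \<theta> qhat = ereal_integral lborel (\<lambda>x. kl_loss q qhat \<theta> x * ereal (p x \<theta>))"

definition dominates :: "('x::euclidean_space \<Rightarrow> 't \<Rightarrow> real) \<Rightarrow> ('y::euclidean_space \<Rightarrow> 't \<Rightarrow> real)
    \<Rightarrow> ('y \<Rightarrow> 'x \<Rightarrow> real) \<Rightarrow> ('y \<Rightarrow> 'x \<Rightarrow> real) \<Rightarrow> bool" where
  "dominates p q qhat1 qhat2 \<longleftrightarrow>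
     (\<forall>\<theta>. kl_risk p q \<theta> qhat1 \<le> kl_risk p q \<theta> qhat2) \<and>
     (\<exists>\<theta>. kl_risk p q \<theta> qhat1 < kl_risk p q \<theta> qhat2)"

definition predictive_density ::
    "('y::euclidean_space \<Rightarrow> 'x::euclidean_space \<Rightarrow> real) \<Rightarrow> bool" where
  "predictive_density qhat \<longleftrightarrow>
     (\<lambda>(y, x). qhat y x) \<in> borel_measurable (borel \<Otimes>\<^sub>M borel) \<and>
     (\<forall>y x. 0 \<le> qhat y x) \<and>
     (\<forall>x. (\<integral>\<^sup>+y. ennreal (qhat y x) \<partial>lborel) = 1)"

definition minimax :: "('x::euclidean_space \<Rightarrow> 't \<Rightarrow> real) \<Rightarrow> ('y::euclidean_space \<Rightarrow> 't \<Rightarrow> real)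
    \<Rightarrow> ('y \<Rightarrow> 'x \<Rightarrow> real) \<Rightarrow> bool" where
  "minimax p q qhat \<longleftrightarrow>
     predictive_density qhat \<and>
     (\<forall>qhat'. predictive_density qhat' \<longrightarrow>
        (SUP \<theta>. kl_risk p q \<theta> qhat) \<le> (SUP \<theta>. kl_risk p q \<theta> qhat'))"

end

theory Submission
  imports Defs
begin

text \<open>
  The vector \<open>H a\<close> is \<open>norm a\<close> times the first unit vector. After the rotation \<open>H\<close> the mixing
  variable therefore moves the first coordinate only, and the density of the model is the product
  of a one-dimensional mean mixture and a spherical normal density in the other \<open>d - 1\<close>
  coordinates (\<open>mmn_pdf_orthogonal\<close>, \<open>mmn_pdf_split_coords\<close>). The prior is flat in the first
  coordinate. So the posterior, and with it the Bayes predictive density, factorises; the first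
  factor belongs to the uniform prior and is the MRE predictive density
  (\<open>bayes_predictive_product\<close>). Lebesgue measure is invariant under \<open>H\<close> and is the product of the
  Lebesgue measures of the two groups of coordinates, which transports all integrals. This is
  part (a).

  The Kullback-Leibler divergence is additive over products (\<open>kl_divergence_product\<close>), hence so is
  the risk (\<open>kl_ennrisk_product\<close>). The predictive densities for \<open>\<pi>\<close> and for the uniform prior share
  the first factor, and their risks share the corresponding summand. Where that summand is
  finite it cancels, and domination in dimension \<open>d\<close> is the same as domination in dimension \<open>d - 1\<close>
  (\<open>dominates_iff\<close>). Domination itself provides a parameter with finite risk, since the risk is
  strictly smaller than another one there.

  A density that dominates a minimax one is minimax, so what remains is that the MRE predictive
  density is minimax (\<open>minimax_mre\<close>). The mixing laws can have arbitrarily heavy tails, so the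
  density \<open>f\<close> of the observation error is first restricted to a ball of radius \<open>k\<close>. This can only
  lower the risk of a predictive density, because all integrands are nonnegative. Average the
  remaining part of the risk over the parameters in a ball of radius \<open>n + k\<close>. For an observation in the ball of radius \<open>n\<close> all parameters compatible with it
  lie in the larger ball. Averaging over them is averaging for a uniform prior, where
  the posterior mixture is optimal (\<open>kl_term_mixture_le\<close>), and its contribution \<open>core_risk k\<close> is the same
  for every observation. Since the ratio of the volumes of the two balls tends to 1, the maximal
  risk is at least \<open>core_risk k\<close>, and Fatou's lemma for \<open>k \<longlonglongrightarrow> \<infinity>\<close> gives the constant risk of the
  MRE predictive density.
\<close>

section \<open>The Kullback-Leibler divergence as an integral of a nonnegative function\<close>

lemma enn2ereal_le_iff: "enn2ereal u \<le> enn2ereal v \<longleftrightarrow> u \<le> v"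
  by (simp add: less_eq_ennreal.rep_eq)

lemma enn2ereal_less_iff: "enn2ereal u < enn2ereal v \<longleftrightarrow> u < v"
  by (simp add: less_ennreal.rep_eq)

lemma enn2ereal_less_infty_iff: "enn2ereal u < \<infinity> \<longleftrightarrow> u < top"
  by (simp add: less_ennreal.rep_eq top_ennreal.rep_eq top_ereal_def)

text \<open>
  Between probability densities, \<open>u ln (u / v)\<close> and \<open>u ln (u / v) - u + v\<close> have the same integral.
  The second integrand is nonnegative, so that divergences and risks become integrals in
  \<^typ>\<open>ennreal\<close>, where Tonelli's theorem and Fatou's lemma apply without integrability conditions.
\<close>

definition kl_term :: "real \<Rightarrow> real \<Rightarrow> ennreal" where
  "kl_term u v = (if u = 0 then ennreal v else if v = 0 then \<infinity> else ennreal (u * ln (u / v) - u + v))"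

lemma kl_term_measurable [measurable (raw)]:
  assumes [measurable]: "f \<in> borel_measurable N" "g \<in> borel_measurable N"
  shows "(\<lambda>z. kl_term (f z) (g z)) \<in> borel_measurable N"
  unfolding kl_term_def by measurable

lemma kl_excess_nonneg:
  fixes u v :: real
  assumes "0 < u" "0 < v"
  shows "0 \<le> u * ln (u / v) - u + v"
proof -
  have "ln (v / u) \<le> v / u - 1"
    using assms by (intro ln_le_minus_one) simp
  then have "u * ln (v / u) \<le> u * (v / u - 1)"
    using assms by (intro mult_left_mono) auto
  moreover have "ln (v / u) = - ln (u / v)"
    using assms by (simp add: ln_div)
  moreover have "u * (v / u - 1) = v - u"
    using assms by (simp add: field_simps)
  ultimately show ?thesis
    by simp
qed

lemma kl_excess_le:
  fixes u v :: real
  assumes "0 < u" "0 < v"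
  shows "u * ln (u / v) - u + v \<le> u\<^sup>2 / v + v"
proof -
  have "u * ln (u / v) \<le> u * (u / v - 1)"
    using assms by (intro mult_left_mono ln_le_minus_one) auto
  also have "\<dots> = u\<^sup>2 / v - u"
    using assms by (simp add: field_simps power2_eq_square)
  finally show ?thesis
    using assms by simp
qed

text \<open>
  The relation between the two integrands, with every term on the side where it is nonnegative,
  so that it can be integrated although some of the terms may be infinite.
\<close>

lemma kl_term_balance:
  assumes "0 \<le> u" "0 \<le> v"
  shows "kl_term u v + ennreal u + e2ennreal (- kl_integrand u v)
       = e2ennreal (kl_integrand u v) + ennreal v"
proof -
  consider "u = 0" | "u > 0" "v = 0" | "u > 0" "v > 0"
    using assms by linarith
  moreover have neg_infty: "e2ennreal (- \<infinity>) = 0"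
    by (simp add: e2ennreal_neg)
  ultimately show ?thesis
  proof cases
    case 3
    show ?thesis
    proof (cases "0 \<le> u * ln (u / v)")
      case True
      then show ?thesis
        using 3 kl_excess_nonneg[OF 3]
        by (simp add: kl_term_def kl_integrand_def e2ennreal_ereal ennreal_neg flip: ennreal_plus)
    next
      case False
      then show ?thesis
        using 3 kl_excess_nonneg[OF 3]
        by (simp add: kl_term_def kl_integrand_def e2ennreal_ereal ennreal_neg flip: ennreal_plus)
    qed
  next
    case 1
    then show ?thesis
      by (simp add: kl_term_def kl_integrand_def e2ennreal_neg)
  next
    case 2
    then show ?thesis
      using neg_infty by (simp add: kl_term_def kl_integrand_def)
  qed
qed

text \<open>
  The negative part of the divergence is always finite. The difference of two integrals in
  \<^const>\<open>ereal_integral\<close> is therefore never \<open>\<infinity> - \<infinity>\<close>.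
\<close>

lemma kl_integrand_neg_part_le:
  assumes "0 \<le> u" "0 \<le> v"
  shows "e2ennreal (- kl_integrand u v) \<le> ennreal v"
  using kl_excess_nonneg[of u v] assms
  by (auto simp: kl_integrand_def e2ennreal_ereal e2ennreal_neg intro!: ennreal_leI)

lemma kl_integrand_measurable [measurable (raw)]:
  assumes [measurable]: "f \<in> borel_measurable N" "g \<in> borel_measurable N"
  shows "(\<lambda>z. kl_integrand (f z) (g z)) \<in> borel_measurable N"
  unfolding kl_integrand_def by measurable

lemma ereal_integral_kl_integrand:
  assumes [measurable]: "u \<in> borel_measurable N" "v \<in> borel_measurable N"
    and nonneg: "\<And>y. 0 \<le> u y" "\<And>y. 0 \<le> v y"
    and prob: "(\<integral>\<^sup>+y. ennreal (u y) \<partial>N) = 1" "(\<integral>\<^sup>+y. ennreal (v y) \<partial>N) = 1"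
  shows "ereal_integral N (\<lambda>y. kl_integrand (u y) (v y))
       = enn2ereal (\<integral>\<^sup>+y. kl_term (u y) (v y) \<partial>N)"
proof -
  let ?K = "\<integral>\<^sup>+y. kl_term (u y) (v y) \<partial>N"
  let ?P = "\<integral>\<^sup>+y. e2ennreal (kl_integrand (u y) (v y)) \<partial>N"
  let ?N = "\<integral>\<^sup>+y. e2ennreal (- kl_integrand (u y) (v y)) \<partial>N"
  have "?N \<le> (\<integral>\<^sup>+y. ennreal (v y) \<partial>N)"
    by (intro nn_integral_mono kl_integrand_neg_part_le nonneg)
  then have fin: "?N < top"
    using prob by (simp add: order.strict_trans1[OF _ ennreal_one_less_top])
  have "?K + 1 + ?N = (\<integral>\<^sup>+y. kl_term (u y) (v y) + ennreal (u y) + e2ennreal (- kl_integrand (u y) (v y)) \<partial>N)"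
    by (simp add: nn_integral_add prob)
  also have "\<dots> = (\<integral>\<^sup>+y. e2ennreal (kl_integrand (u y) (v y)) + ennreal (v y) \<partial>N)"
    by (simp add: kl_term_balance nonneg)
  also have "\<dots> = ?P + 1"
    by (simp add: nn_integral_add prob)
  finally have "1 + (?K + ?N) = 1 + ?P"
    by (simp add: ac_simps)
  then have "?K + ?N = ?P"
    by (simp add: ennreal_add_left_cancel)
  then have "enn2ereal ?P = enn2ereal ?K + enn2ereal ?N"
    by (metis plus_ennreal.rep_eq)
  moreover have "\<bar>enn2ereal ?N\<bar> \<noteq> \<infinity>"
    using fin by (cases ?N) auto
  ultimately show ?thesis
    unfolding ereal_integral_def by (cases "enn2ereal ?K"; cases "enn2ereal ?N") auto
qed

text \<open>
  For positive arguments the identity follows from additivity of the logarithm. It is written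
  without subtraction so that it survives a vanishing density, where both sides can be infinite.
  The correction terms all integrate to 1.
\<close>

lemma kl_term_product:
  assumes "0 \<le> u\<^sub>1" "0 \<le> u\<^sub>2" "0 \<le> v\<^sub>1" "0 \<le> v\<^sub>2"
  shows "kl_term (u\<^sub>1 * u\<^sub>2) (v\<^sub>1 * v\<^sub>2) + ennreal u\<^sub>2 * ennreal v\<^sub>1 + ennreal u\<^sub>1 * ennreal v\<^sub>2
       = ennreal u\<^sub>2 * kl_term u\<^sub>1 v\<^sub>1 + ennreal u\<^sub>1 * kl_term u\<^sub>2 v\<^sub>2
         + ennreal u\<^sub>1 * ennreal u\<^sub>2 + ennreal v\<^sub>1 * ennreal v\<^sub>2"
proof -
  consider "u\<^sub>1 = 0 \<or> u\<^sub>2 = 0" | "u\<^sub>1 > 0" "u\<^sub>2 > 0" "v\<^sub>1 = 0 \<or> v\<^sub>2 = 0"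
    | "u\<^sub>1 > 0" "u\<^sub>2 > 0" "v\<^sub>1 > 0" "v\<^sub>2 > 0"
    using assms by linarith
  then show ?thesis
  proof cases
    case 1
    then show ?thesis
      using assms by (auto simp: kl_term_def ennreal_mult ac_simps)
  next
    case 2
    then show ?thesis
      using assms by (auto simp: kl_term_def ennreal_mult_top)
  next
    case 3
    have "ln (u\<^sub>1 * u\<^sub>2 / (v\<^sub>1 * v\<^sub>2)) = ln (u\<^sub>1 / v\<^sub>1) + ln (u\<^sub>2 / v\<^sub>2)"
      using 3 by (simp add: ln_mult ln_div)
    then show ?thesis
      using 3 kl_excess_nonneg[of u\<^sub>1 v\<^sub>1] kl_excess_nonneg[of u\<^sub>2 v\<^sub>2]
        kl_excess_nonneg[of "u\<^sub>1 * u\<^sub>2" "v\<^sub>1 * v\<^sub>2"]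
      by (simp add: kl_term_def flip: ennreal_mult ennreal_plus)
         (auto intro!: arg_cong[where f=ennreal] simp: algebra_simps)
  qed
qed

text \<open>
  Among all predictions \<open>r\<close> for densities \<open>u z\<close> that are averaged with weights \<open>w z\<close>, the weighted
  mean is the best one: with \<open>m\<close> for the mean and \<open>c\<close> for the total weight, the two sides differ
  by \<open>c (m ln (m / r) - m + r) \<ge> 0\<close>. The bound \<open>C\<close> makes all integrals finite unless \<open>r = 0\<close>, where
  the right-hand side is infinite.
\<close>

lemma kl_term_mixture_le:
  fixes w u :: "'a \<Rightarrow> real"
  assumes int: "integrable N w" and w: "\<And>z. 0 \<le> w z" and c: "0 < (\<integral>z. w z \<partial>N)"
    and u [measurable]: "u \<in> borel_measurable N" and pos: "\<And>z. 0 < u z" and le: "\<And>z. u z \<le> C"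
    and r: "0 \<le> r"
  shows "(\<integral>\<^sup>+z. ennreal (w z) * kl_term (u z) ((\<integral>z. w z * u z \<partial>N) / (\<integral>z. w z \<partial>N)) \<partial>N)
       \<le> (\<integral>\<^sup>+z. ennreal (w z) * kl_term (u z) r \<partial>N)"
proof -
  let ?c = "\<integral>z. w z \<partial>N"
  define ub where "ub = (\<integral>z. w z * u z \<partial>N) / ?c"
  have [measurable]: "w \<in> borel_measurable N"
    using int by auto
  have int_bounded: "integrable N (\<lambda>z. w z * h z)"
    if [measurable]: "h \<in> borel_measurable N" and "\<And>z. \<bar>h z\<bar> \<le> B" for h B
  proof (rule Bochner_Integration.integrable_bound[OF integrable_mult_left[OF int, of B]])
    show "AE z in N. norm (w z * h z) \<le> norm (w z * B)"
      using that(2) w by (intro AE_I2) (auto simp: abs_mult intro!: mult_left_mono order_trans[OF that(2)])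
  qed auto
  have int_u: "integrable N (\<lambda>z. w z * u z)"
    using pos le by (intro int_bounded[of u C]) (auto simp: abs_of_pos)
  have ub: "0 < ub"
  proof -
    have "(\<integral>z. w z * u z \<partial>N) \<noteq> 0"
    proof
      assume "(\<integral>z. w z * u z \<partial>N) = 0"
      then have "AE z in N. w z * u z = 0"
        using w pos by (subst (asm) integral_nonneg_eq_0_iff_AE[OF int_u]) (auto simp: less_imp_le)
      then have "AE z in N. w z = 0"
        by (rule eventually_mono) (metis less_irrefl mult_eq_0_iff pos)
      then have "?c = 0"
        using integral_cong_AE[of w N "\<lambda>_. 0"] by simp
      with c show False by simp
    qed
    moreover have "0 \<le> (\<integral>z. w z * u z \<partial>N)"
      using w pos by (intro Bochner_Integration.integral_nonneg) (auto simp: less_imp_le)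
    ultimately show ?thesis
      using c by (simp add: ub_def)
  qed
  show ?thesis
  proof (cases "r = 0")
    case True
    have "(\<integral>\<^sup>+z. ennreal (w z) * kl_term (u z) r \<partial>N) = (\<integral>\<^sup>+z. ennreal (w z) \<partial>N) * \<infinity>"
      using True pos by (subst nn_integral_multc[symmetric]) (auto simp: kl_term_def less_imp_neq[OF pos, symmetric])
    also have "\<dots> = \<infinity>"
      using c w by (subst nn_integral_eq_integral[OF int]) (auto simp: ennreal_mult_top)
    finally show ?thesis by simp
  next
    case False
    then have r: "0 < r" using r by simp
    define \<phi> where "\<phi> v z = u z * ln (u z / v) - u z + v" for v z
    have nn: "0 \<le> \<phi> v z" if "0 < v" for v z
      unfolding \<phi>_def using kl_excess_nonneg[OF pos that] .
    have [measurable]: "\<phi> v \<in> borel_measurable N" for v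
      unfolding \<phi>_def by measurable
    have int_phi: "integrable N (\<lambda>z. w z * \<phi> v z)" if "0 < v" for v
    proof (rule int_bounded[where B = "C\<^sup>2 / v + v"])
      fix z
      have "(u z)\<^sup>2 / v \<le> C\<^sup>2 / v"
        using pos[of z] le[of z] that by (intro divide_right_mono power_mono) auto
      then show "\<bar>\<phi> v z\<bar> \<le> C\<^sup>2 / v + v"
        using nn[OF that, of z] kl_excess_le[OF pos that, of z] by (simp add: \<phi>_def)
    qed simp
    have eq: "(\<integral>\<^sup>+z. ennreal (w z) * kl_term (u z) v \<partial>N) = ennreal (\<integral>z. w z * \<phi> v z \<partial>N)" if "0 < v" for v
    proof -
      have "(\<integral>\<^sup>+z. ennreal (w z) * kl_term (u z) v \<partial>N) = (\<integral>\<^sup>+z. ennreal (w z * \<phi> v z) \<partial>N)"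
        using that w pos nn by (intro nn_integral_cong) (auto simp: kl_term_def \<phi>_def ennreal_mult less_imp_neq[OF pos, symmetric])
      also have "\<dots> = ennreal (\<integral>z. w z * \<phi> v z \<partial>N)"
        using int_phi[OF that] nn[OF that] w by (intro nn_integral_eq_integral) auto
      finally show ?thesis .
    qed
    have "\<phi> r z = \<phi> ub z + (u z * ln (ub / r) + (r - ub))" for z
      using r ub pos[of z] by (simp add: \<phi>_def ln_div algebra_simps)
    then have "w z * \<phi> r z = w z * \<phi> ub z + (w z * u z * ln (ub / r) + w z * (r - ub))" for z
      by (simp add: distrib_left mult.assoc)
    then have "(\<integral>z. w z * \<phi> r z \<partial>N)
        = (\<integral>z. w z * \<phi> ub z + (w z * u z * ln (ub / r) + w z * (r - ub)) \<partial>N)"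
      by simp
    also have "\<dots> = (\<integral>z. w z * \<phi> ub z \<partial>N) + ((\<integral>z. w z * u z \<partial>N) * ln (ub / r) + ?c * (r - ub))"
      using int_phi[OF ub] int_u int by simp
    also have "(\<integral>z. w z * u z \<partial>N) = ?c * ub"
      using c by (simp add: ub_def)
    also have "?c * ub * ln (ub / r) + ?c * (r - ub) = ?c * (ub * ln (ub / r) - ub + r)"
      by (simp add: algebra_simps)
    finally have "(\<integral>z. w z * \<phi> ub z \<partial>N) \<le> (\<integral>z. w z * \<phi> r z \<partial>N)"
      using c kl_excess_nonneg[OF ub r] by simp
    then show ?thesis
      unfolding eq[OF r] using eq[OF ub] by (simp add: ub_def ennreal_leI)
  qed
qed

lemma kl_divergence_product:
  fixes u\<^sub>1 v\<^sub>1 :: "'a::euclidean_space \<Rightarrow> real" and u\<^sub>2 v\<^sub>2 :: "'b::euclidean_space \<Rightarrow> real"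
  assumes [measurable]: "u\<^sub>1 \<in> borel_measurable borel" "v\<^sub>1 \<in> borel_measurable borel"
      "u\<^sub>2 \<in> borel_measurable borel" "v\<^sub>2 \<in> borel_measurable borel"
    and nonneg: "\<And>a. 0 \<le> u\<^sub>1 a" "\<And>a. 0 \<le> v\<^sub>1 a" "\<And>b. 0 \<le> u\<^sub>2 b" "\<And>b. 0 \<le> v\<^sub>2 b"
    and prob: "(\<integral>\<^sup>+a. ennreal (u\<^sub>1 a) \<partial>lborel) = 1" "(\<integral>\<^sup>+a. ennreal (v\<^sub>1 a) \<partial>lborel) = 1"
      "(\<integral>\<^sup>+b. ennreal (u\<^sub>2 b) \<partial>lborel) = 1" "(\<integral>\<^sup>+b. ennreal (v\<^sub>2 b) \<partial>lborel) = 1"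
  shows "(\<integral>\<^sup>+a. \<integral>\<^sup>+b. kl_term (u\<^sub>1 a * u\<^sub>2 b) (v\<^sub>1 a * v\<^sub>2 b) \<partial>lborel \<partial>lborel)
       = (\<integral>\<^sup>+a. kl_term (u\<^sub>1 a) (v\<^sub>1 a) \<partial>lborel) + (\<integral>\<^sup>+b. kl_term (u\<^sub>2 b) (v\<^sub>2 b) \<partial>lborel)"
    (is "?K = ?K\<^sub>1 + ?K\<^sub>2")
proof -
  have "?K + 1 + 1 = (\<integral>\<^sup>+a. \<integral>\<^sup>+b. kl_term (u\<^sub>1 a * u\<^sub>2 b) (v\<^sub>1 a * v\<^sub>2 b)
      + ennreal (u\<^sub>2 b) * ennreal (v\<^sub>1 a) + ennreal (u\<^sub>1 a) * ennreal (v\<^sub>2 b) \<partial>lborel \<partial>lborel)"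
    by (simp add: nn_integral_add nn_integral_cmult nn_integral_multc prob)
  also have "\<dots> = (\<integral>\<^sup>+a. \<integral>\<^sup>+b. ennreal (u\<^sub>2 b) * kl_term (u\<^sub>1 a) (v\<^sub>1 a) + ennreal (u\<^sub>1 a) * kl_term (u\<^sub>2 b) (v\<^sub>2 b)
         + ennreal (u\<^sub>1 a) * ennreal (u\<^sub>2 b) + ennreal (v\<^sub>1 a) * ennreal (v\<^sub>2 b) \<partial>lborel \<partial>lborel)"
    by (simp add: kl_term_product nonneg)
  also have "\<dots> = ?K\<^sub>1 + ?K\<^sub>2 + 1 + 1"
    by (simp add: nn_integral_add nn_integral_cmult nn_integral_multc prob)
  finally have "1 + (1 + ?K) = 1 + (1 + (?K\<^sub>1 + ?K\<^sub>2))"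
    by (simp add: ac_simps)
  then show ?thesis
    by (simp add: ennreal_add_left_cancel)
qed

lemma kl_term_tendsto:
  assumes "0 < u" "0 < v" and v: "(\<lambda>k. v' k) \<longlonglongrightarrow> v"
  shows "(\<lambda>k. kl_term u (v' k)) \<longlonglongrightarrow> kl_term u v"
proof -
  have "\<forall>\<^sub>F k in sequentially. 0 < v' k"
    using order_tendstoD(1)[OF v \<open>0 < v\<close>] .
  then have "\<forall>\<^sub>F k in sequentially. ennreal (u * ln (u / v' k) - u + v' k) = kl_term u (v' k)"
    by (rule eventually_mono) (use assms in \<open>auto simp: kl_term_def\<close>)
  moreover have "(\<lambda>k. ennreal (u * ln (u / v' k) - u + v' k)) \<longlonglongrightarrow> ennreal (u * ln (u / v) - u + v)"
    using assms by (intro tendsto_intros) auto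
  ultimately show ?thesis
    using assms by (simp add: kl_term_def[of u v] tendsto_cong)
qed

section \<open>Densities and Bayes predictive densities\<close>

text \<open>
  Boundedness keeps the integrals that define predictive densities finite at every point, where
  integrability alone would give this only almost everywhere.
\<close>

definition regular_density :: "('x::euclidean_space \<Rightarrow> 't::euclidean_space \<Rightarrow> real) \<Rightarrow> bool" where
  "regular_density p \<longleftrightarrow>
     (\<lambda>(x, \<theta>). p x \<theta>) \<in> borel_measurable (borel \<Otimes>\<^sub>M borel) \<and>
     (\<exists>C. \<forall>x \<theta>. 0 < p x \<theta> \<and> p x \<theta> \<le> C) \<and>
     (\<forall>\<theta>. (\<integral>\<^sup>+x. ennreal (p x \<theta>) \<partial>lborel) = 1)"

lemma regular_densityD:
  assumes "regular_density p"
  shows regular_density_measurable: "(\<lambda>(x, \<theta>). p x \<theta>) \<in> borel_measurable (borel \<Otimes>\<^sub>M borel)"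
    and regular_density_pos: "0 < p x \<theta>"
    and regular_density_bounded: "\<exists>C. \<forall>x \<theta>. p x \<theta> \<le> C"
    and regular_density_prob: "(\<integral>\<^sup>+x. ennreal (p x \<theta>) \<partial>lborel) = 1"
  using assms by (auto simp: regular_density_def)

lemma regular_density_measurable_comp:
  assumes "regular_density p" and [measurable]: "f \<in> borel_measurable N" "g \<in> borel_measurable N"
  shows "(\<lambda>z. p (f z) (g z)) \<in> borel_measurable N"
proof -
  note regular_density_measurable[OF assms(1), measurable]
  have "(\<lambda>z. (\<lambda>(x, \<theta>). p x \<theta>) (f z, g z)) \<in> borel_measurable N"
    by measurable
  then show ?thesis by simp
qed

text \<open>
  All integrands are nonnegative, so the Bochner integrals that define the predictive density can be
  replaced by nonnegative integrals, for which Tonelli and product formulas are unconditional.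
\<close>

lemma bayes_predictive_eq_ratio:
  assumes "regular_density p" "regular_density q"
    and [measurable]: "\<pi> \<in> borel_measurable borel" and \<pi>: "\<And>\<theta>. 0 \<le> \<pi> \<theta>"
  shows "bayes_predictive p q \<pi> y x
       = enn2real (\<integral>\<^sup>+\<theta>. ennreal (q y \<theta> * (p x \<theta> * \<pi> \<theta>)) \<partial>lborel)
         / enn2real (\<integral>\<^sup>+\<theta>. ennreal (p x \<theta> * \<pi> \<theta>) \<partial>lborel)"
proof -
  note [measurable] = regular_density_measurable_comp[OF assms(1)] regular_density_measurable_comp[OF assms(2)]
  have nn: "0 \<le> p x \<theta>" "0 \<le> q y \<theta>" for \<theta>
    using assms(1,2) by (auto intro: less_imp_le regular_density_pos)
  have "bayes_predictive p q \<pi> y x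
      = (\<integral>\<theta>. q y \<theta> * (p x \<theta> * \<pi> \<theta>) \<partial>lborel) / (\<integral>\<theta>. p x \<theta> * \<pi> \<theta> \<partial>lborel)"
    by (simp add: bayes_predictive_def posterior_pdf_def)
  also have "(\<integral>\<theta>. q y \<theta> * (p x \<theta> * \<pi> \<theta>) \<partial>lborel) = enn2real (\<integral>\<^sup>+\<theta>. ennreal (q y \<theta> * (p x \<theta> * \<pi> \<theta>)) \<partial>lborel)"
    by (rule integral_eq_nn_integral) (use nn \<pi> in \<open>auto intro!: mult_nonneg_nonneg\<close>)
  also have "(\<integral>\<theta>. p x \<theta> * \<pi> \<theta> \<partial>lborel) = enn2real (\<integral>\<^sup>+\<theta>. ennreal (p x \<theta> * \<pi> \<theta>) \<partial>lborel)"
    by (rule integral_eq_nn_integral) (use nn \<pi> in \<open>auto intro!: mult_nonneg_nonneg\<close>)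
  finally show ?thesis .
qed

text \<open>
  The total mass is 1 by Tonelli's theorem. Boundedness of \<open>q\<close> makes the numerator finite, so that
  \<^const>\<open>enn2real\<close> does not return its default value 0.
\<close>

lemma predictive_density_bayes:
  assumes p: "regular_density p" and q: "regular_density q"
    and [measurable]: "\<pi> \<in> borel_measurable borel" and \<pi>: "\<And>\<theta>. 0 \<le> \<pi> \<theta>"
    and wd: "posterior_well_defined p \<pi>"
  shows "predictive_density (bayes_predictive p q \<pi>)"
proof -
  note [measurable] = regular_density_measurable_comp[OF p] regular_density_measurable_comp[OF q]
  obtain C where C: "\<And>y \<theta>. q y \<theta> \<le> C"
    using regular_density_bounded[OF q] by auto
  have nn: "0 \<le> p x \<theta> * \<pi> \<theta>" "0 \<le> q y \<theta>" for x y \<theta>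
    using \<pi> regular_density_pos[OF p] regular_density_pos[OF q] by (simp_all add: less_imp_le)
  let ?D = "\<lambda>x. \<integral>\<^sup>+\<theta>. ennreal (p x \<theta> * \<pi> \<theta>) \<partial>lborel"
  let ?N = "\<lambda>y x. \<integral>\<^sup>+\<theta>. ennreal (q y \<theta>) * ennreal (p x \<theta> * \<pi> \<theta>) \<partial>lborel"
  have D: "0 < ?D x" "?D x < top" for x
    using wd by (auto simp: posterior_well_defined_def)
  have N: "?N y x < top" for y x
  proof -
    have "?N y x \<le> (\<integral>\<^sup>+\<theta>. ennreal C * ennreal (p x \<theta> * \<pi> \<theta>) \<partial>lborel)"
      by (intro nn_integral_mono mult_right_mono ennreal_leI C) auto
    also have "\<dots> < top"
      using D by (simp add: nn_integral_cmult ennreal_mult_less_top)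
    finally show ?thesis .
  qed
  have eq: "bayes_predictive p q \<pi> y x = enn2real (?N y x) / enn2real (?D x)" for y x
    using bayes_predictive_eq_ratio[OF p q _ \<pi>, where y=y and x=x] nn by (simp add: ennreal_mult)
  have "(\<integral>\<^sup>+y. ennreal (bayes_predictive p q \<pi> y x) \<partial>lborel) = 1" for x
  proof -
    have "ennreal (bayes_predictive p q \<pi> y x) = ?N y x / ?D x" for y
      using N[of y x] D[of x] unfolding eq
      by (subst divide_ennreal[symmetric]) (auto simp: enn2real_positive_iff)
    then have "(\<integral>\<^sup>+y. ennreal (bayes_predictive p q \<pi> y x) \<partial>lborel) = (\<integral>\<^sup>+y. ?N y x \<partial>lborel) / ?D x"
      by (simp add: nn_integral_divide)
    also have "(\<integral>\<^sup>+y. ?N y x \<partial>lborel)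
        = (\<integral>\<^sup>+\<theta>. \<integral>\<^sup>+y. ennreal (q y \<theta>) * ennreal (p x \<theta> * \<pi> \<theta>) \<partial>lborel \<partial>lborel)"
      by (rule lborel_pair.Fubini') measurable
    also have "\<dots> = ?D x"
      by (simp add: nn_integral_multc regular_density_prob[OF q])
    finally show ?thesis
      using D[of x] by (simp add: ennreal_divide_self)
  qed
  moreover have "(\<lambda>(y, x). bayes_predictive p q \<pi> y x) \<in> borel_measurable (borel \<Otimes>\<^sub>M borel)"
    unfolding eq by measurable
  ultimately show ?thesis
    by (simp add: predictive_density_def eq)
qed

section \<open>Risks as nonnegative integrals\<close>

text \<open>
  The risk, computed with the nonnegative integrand; \<open>kl_risk_eq_ennrisk\<close> is the agreement with
  \<^const>\<open>kl_risk\<close> on predictive densities.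
\<close>

definition kl_ennrisk where
  "kl_ennrisk p q \<theta> r = (\<integral>\<^sup>+x. ennreal (p x \<theta>) * (\<integral>\<^sup>+y. kl_term (q y \<theta>) (r y x) \<partial>lborel) \<partial>lborel)"

lemma kl_risk_eq_ennrisk:
  fixes p :: "'x::euclidean_space \<Rightarrow> 't \<Rightarrow> real" and q :: "'y::euclidean_space \<Rightarrow> 't \<Rightarrow> real"
  assumes [measurable]: "(\<lambda>x. p x \<theta>) \<in> borel_measurable borel" "(\<lambda>y. q y \<theta>) \<in> borel_measurable borel"
    and "\<And>x. 0 \<le> p x \<theta>" "\<And>y. 0 \<le> q y \<theta>" "(\<integral>\<^sup>+y. ennreal (q y \<theta>) \<partial>lborel) = 1"
    and r: "predictive_density r"
  shows "kl_risk p q \<theta> r = enn2ereal (kl_ennrisk p q \<theta> r)"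
proof -
  have [measurable]: "(\<lambda>(y, x). r y x) \<in> borel_measurable (borel \<Otimes>\<^sub>M borel)"
    and r_nonneg: "\<And>y x. 0 \<le> r y x" and r_prob: "\<And>x. (\<integral>\<^sup>+y. ennreal (r y x) \<partial>lborel) = 1"
    using r by (auto simp: predictive_density_def)
  let ?K = "\<lambda>x. \<integral>\<^sup>+y. kl_term (q y \<theta>) (r y x) \<partial>lborel"
  have loss: "kl_loss q r \<theta> x = enn2ereal (?K x)" for x
    unfolding kl_loss_def
    by (rule ereal_integral_kl_integrand) (use assms r_nonneg r_prob in auto)
  have "kl_loss q r \<theta> x * ereal (p x \<theta>) = enn2ereal (ennreal (p x \<theta>) * ?K x)" for x
    using assms(3) by (simp add: loss times_ennreal.rep_eq mult.commute)
  moreover have "e2ennreal (- enn2ereal z) = 0" for z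
    by (rule e2ennreal_neg) simp
  ultimately show ?thesis
    unfolding kl_risk_def kl_ennrisk_def ereal_integral_def by (simp add: zero_ennreal.rep_eq)
qed

lemma kl_risk_regular:
  assumes "regular_density p" "regular_density q" "predictive_density r"
  shows "kl_risk p q \<theta> r = enn2ereal (kl_ennrisk p q \<theta> r)"
proof -
  note [measurable] = assms(1,2)[THEN regular_density_measurable_comp]
  show ?thesis
    by (rule kl_risk_eq_ennrisk)
       (use assms in \<open>auto intro: less_imp_le regular_density_pos regular_density_prob\<close>)
qed

lemma minimax_if_dominates_minimax:
  assumes "minimax p q s" "dominates p q r s" "predictive_density r"
  shows "minimax p q r"
proof -
  have "(SUP \<theta>. kl_risk p q \<theta> r) \<le> (SUP \<theta>. kl_risk p q \<theta> s)"
    using assms(2) by (intro SUP_mono) (auto simp: dominates_def)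
  then show ?thesis
    using assms unfolding minimax_def by (meson order_trans)
qed

section \<open>Lebesgue measure under translations, rotations and splitting of coordinates\<close>

lemma ball_in_sets_borel [simp, measurable]: "ball c r \<in> sets borel"
  by (simp add: borel_open)

lemma nn_integral_lborel_shift:
  fixes h :: "'a::euclidean_space \<Rightarrow> ennreal"
  assumes [measurable]: "h \<in> borel_measurable borel"
  shows "(\<integral>\<^sup>+x. h (c + x) \<partial>lborel) = (\<integral>\<^sup>+x. h x \<partial>lborel)"
  by (subst (2) lborel_distr_plus[symmetric, of c]) (simp add: nn_integral_distr)

lemma nn_integral_lborel_reflect:
  fixes h :: "'a::euclidean_space \<Rightarrow> ennreal"
  assumes [measurable]: "h \<in> borel_measurable borel"
  shows "(\<integral>\<^sup>+x. h (c - x) \<partial>lborel) = (\<integral>\<^sup>+x. h x \<partial>lborel)"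
proof -
  have "(lborel :: 'a measure) = distr lborel borel (\<lambda>x. c - x)"
    using lborel_affine[of "-1" c] by (simp add: density_1)
  then have "(\<integral>\<^sup>+x. h x \<partial>lborel) = (\<integral>\<^sup>+x. h x \<partial>distr lborel borel (\<lambda>x. c - x))"
    by simp
  then show ?thesis
    by (simp add: nn_integral_distr)
qed

text \<open>
  This is uniqueness of translation-invariant measures in the case at hand. With \<open>B\<close> the indicator
  of the unit ball, integrate \<open>B x * h (T x + y)\<close> over \<open>x\<close> and \<open>y\<close>. Integrating over \<open>y\<close> first gives
  the volume of the ball times the integral of \<open>h\<close>. Substituting \<open>x - T\<^sup>-\<^sup>1 y\<close> for \<open>x\<close> first gives the
  volume of the ball times the integral of \<open>h \<circ> T\<close>, because \<open>T\<close> preserves the ball.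
\<close>

lemma nn_integral_lborel_orthogonal:
  fixes T :: "'a::euclidean_space \<Rightarrow> 'a" and h :: "'a \<Rightarrow> ennreal"
  assumes T: "orthogonal_transformation T" and [measurable]: "h \<in> borel_measurable borel"
  shows "(\<integral>\<^sup>+x. h (T x) \<partial>lborel) = (\<integral>\<^sup>+x. h x \<partial>lborel)"
proof -
  let ?B = "indicator (ball 0 1) :: 'a \<Rightarrow> ennreal"
  obtain S where S: "orthogonal_transformation S" "\<And>x. S (T x) = x" "\<And>x. T (S x) = x"
    using T by (metis orthogonal_transformation_inv orthogonal_transformation_bij bij_inv_eq_iff)
  note lin = orthogonal_transformation_linear[OF T]
  have [measurable]: "T \<in> borel_measurable borel" "S \<in> borel_measurable borel"
    using T S(1) by (auto intro!: borel_measurable_continuous_onI linear_continuous_on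
      simp: orthogonal_transformation_linear linear_conv_bounded_linear[symmetric])
  define c where "c = (\<integral>\<^sup>+x. ?B x \<partial>lborel)"
  have c: "c \<noteq> 0" "c \<noteq> top"
    using unit_ball_vol_pos[of "real DIM('a)"]
    by (auto simp: c_def emeasure_ball ennreal_eq_0_iff simp del: unit_ball_vol_pos)
  have "c * (\<integral>\<^sup>+x. h x \<partial>lborel) = (\<integral>\<^sup>+x. \<integral>\<^sup>+y. ?B x * h (T x + y) \<partial>lborel \<partial>lborel)"
    unfolding c_def by (simp add: nn_integral_cmult nn_integral_lborel_shift nn_integral_multc)
  also have "\<dots> = (\<integral>\<^sup>+y. \<integral>\<^sup>+x. ?B x * h (T x + y) \<partial>lborel \<partial>lborel)"
    by (rule lborel_pair.Fubini') measurable
  also have "\<dots> = (\<integral>\<^sup>+y. \<integral>\<^sup>+x. ?B (x - S y) * h (T x) \<partial>lborel \<partial>lborel)"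
  proof (rule nn_integral_cong)
    fix y
    have "(\<integral>\<^sup>+x. ?B (x - S y) * h (T x) \<partial>lborel) = (\<integral>\<^sup>+x. ?B (S y + x - S y) * h (T (S y + x)) \<partial>lborel)"
      by (rule nn_integral_lborel_shift[symmetric]) measurable
    moreover have "S y + x - S y = x" "T (S y + x) = T x + y" for x
      using S(3) by (simp_all add: linear_add[OF lin])
    ultimately show "(\<integral>\<^sup>+x. ?B x * h (T x + y) \<partial>lborel) = (\<integral>\<^sup>+x. ?B (x - S y) * h (T x) \<partial>lborel)"
      by (simp only:)
  qed
  also have "\<dots> = (\<integral>\<^sup>+x. \<integral>\<^sup>+y. ?B (x - S y) * h (T x) \<partial>lborel \<partial>lborel)"
    by (rule lborel_pair.Fubini') measurable
  also have "\<dots> = (\<integral>\<^sup>+x. \<integral>\<^sup>+y. ?B (T x - y) * h (T x) \<partial>lborel \<partial>lborel)"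
  proof -
    have "norm (x - S y) = norm (T x - y)" for x y
      using orthogonal_transformation_norm[OF T, of "x - S y"] by (simp add: linear_diff[OF lin] S(3))
    then have "?B (x - S y) = ?B (T x - y)" for x y
      by (simp add: indicator_def)
    then show ?thesis
      by (simp only:)
  qed
  also have "\<dots> = c * (\<integral>\<^sup>+x. h (T x) \<partial>lborel)"
  proof -
    have "(\<integral>\<^sup>+y. ?B (T x - y) \<partial>lborel) = c" for x
      unfolding c_def by (rule nn_integral_lborel_reflect) measurable
    then show ?thesis
      by (simp add: nn_integral_multc nn_integral_cmult)
  qed
  finally show ?thesis
    using c by (simp add: ennreal_mult_cancel_left)
qed

lemma coords_measurable [measurable]:
  "(fst_coord :: real ^ 'm::finite option \<Rightarrow> real ^ 1) \<in> borel_measurable borel"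
  "(rest_coords :: real ^ 'm option \<Rightarrow> real ^ 'm) \<in> borel_measurable borel"
  unfolding fst_coord_def rest_coords_def vec_def
  by (intro borel_measurable_continuous_onI continuous_intros)+

lemma matrix_vector_mult_measurable [measurable]:
  "(*v) A \<in> borel_measurable (borel :: (real ^ 'n::finite) measure)"
  by (intro borel_measurable_continuous_onI linear_continuous_on matrix_vector_mul_bounded_linear)

lemma prod_Basis_cart:
  "(\<Prod>b\<in>Basis. x \<bullet> b) = (\<Prod>i\<in>UNIV. (x :: real ^ 'n::finite) $ i)"
proof -
  have basis: "(Basis :: (real ^ 'n) set) = (\<lambda>i. axis i 1) ` UNIV"
    by (auto simp: Basis_vec_def)
  have "inj (\<lambda>i::'n. axis i (1::real))"
    by (auto intro!: injI simp: axis_eq_axis)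
  then show ?thesis
    unfolding basis by (simp add: prod.reindex inner_axis)
qed

lemma emeasure_lborel_box_cart:
  fixes l u :: "real ^ 'n::finite"
  assumes "\<And>i. l $ i \<le> u $ i"
  shows "emeasure lborel (box l u) = ennreal (\<Prod>i\<in>UNIV. u $ i - l $ i)"
proof -
  have "l \<bullet> b \<le> u \<bullet> b" if "b \<in> Basis" for b
    using that assms by (auto simp: Basis_vec_def inner_axis)
  then show ?thesis
    by (simp add: emeasure_lborel_box prod_Basis_cart)
qed

text \<open>
  Boxes are products of boxes in the two groups of coordinates, and their volumes multiply.
\<close>

lemma nn_integral_split_coords:
  fixes h :: "(real ^ 1) \<times> (real ^ 'm::finite) \<Rightarrow> ennreal"
  assumes h: "h \<in> borel_measurable (borel \<Otimes>\<^sub>M borel)"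
  shows "(\<integral>\<^sup>+x. h (fst_coord x, rest_coords x) \<partial>lborel) = (\<integral>\<^sup>+a. \<integral>\<^sup>+b. h (a, b) \<partial>lborel \<partial>lborel)"
proof -
  define J :: "(real ^ 1) \<times> (real ^ 'm) \<Rightarrow> real ^ 'm option"
    where "J ab = (\<chi> i. case i of None \<Rightarrow> fst ab $ 1 | Some j \<Rightarrow> snd ab $ j)" for ab
  have J: "fst_coord (J ab) = fst ab" "rest_coords (J ab) = snd ab" for ab
    by (simp_all add: J_def fst_coord_def rest_coords_def vec_eq_iff)
  have [measurable]: "J \<in> borel_measurable (lborel \<Otimes>\<^sub>M lborel)"
  proof -
    have "continuous_on UNIV (\<lambda>ab. (J ab) $ i)" for i
      by (cases i) (auto simp: J_def intro!: continuous_intros)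
    then have "J \<in> borel_measurable borel"
      by (intro borel_measurable_continuous_onI) (simp add: continuous_on_vec_lambda[of UNIV "\<lambda>i ab. J ab $ i", simplified])
    then show ?thesis
      by (simp add: lborel_prod)
  qed
  have lborel_eq: "(lborel :: (real ^ 'm option) measure) = distr (lborel \<Otimes>\<^sub>M lborel) borel J"
  proof (rule lborel_eqI)
    fix l u :: "real ^ 'm option"
    assume le: "\<And>b. b \<in> Basis \<Longrightarrow> l \<bullet> b \<le> u \<bullet> b"
    have le': "l $ i \<le> u $ i" for i
      using le[of "axis i 1"] by (simp add: inner_axis axis_in_Basis_iff)
    have pre: "J -` box l u = box (fst_coord l) (fst_coord u) \<times> box (rest_coords l) (rest_coords u)"
      by (auto simp: mem_box_cart J_def fst_coord_def rest_coords_def split: option.splits)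
    have "emeasure (distr (lborel \<Otimes>\<^sub>M lborel) borel J) (box l u)
        = emeasure lborel (box (fst_coord l) (fst_coord u)) * emeasure lborel (box (rest_coords l) (rest_coords u))"
      by (simp add: emeasure_distr pre lborel.emeasure_pair_measure_Times space_pair_measure)
    also have "\<dots> = ennreal ((u $ None - l $ None) * (\<Prod>i\<in>UNIV. u $ Some i - l $ Some i))"
      using le' by (simp add: emeasure_lborel_box_cart ennreal_mult prod_nonneg fst_coord_def rest_coords_def)
    also have "(u $ None - l $ None) * (\<Prod>i\<in>UNIV. u $ Some i - l $ Some i) = (\<Prod>i\<in>UNIV. (u - l) $ i)"
      by (simp add: UNIV_option_conv prod.reindex)
    finally show "emeasure (distr (lborel \<Otimes>\<^sub>M lborel) borel J) (box l u) = (\<Prod>b\<in>Basis. (u - l) \<bullet> b)"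
      by (simp add: prod_Basis_cart)
  qed simp
  note [measurable] = h
  from lborel_eq have "(\<integral>\<^sup>+x. h (fst_coord x, rest_coords x) \<partial>lborel)
      = (\<integral>\<^sup>+x. h (fst_coord x, rest_coords x) \<partial>distr (lborel \<Otimes>\<^sub>M lborel) borel J)"
    by simp
  also have "\<dots> = (\<integral>\<^sup>+ab. h ab \<partial>(lborel \<Otimes>\<^sub>M lborel))"
    by (subst nn_integral_distr) (simp_all add: J)
  also have "\<dots> = (\<integral>\<^sup>+a. \<integral>\<^sup>+b. h (a, b) \<partial>lborel \<partial>lborel)"
    by (subst lborel.nn_integral_fst[symmetric]) auto
  finally show ?thesis .
qed

section \<open>Minimaxity of the MRE predictive density in a location model\<close>

text \<open>
  Observation and predicted variable have densities \<open>f (x - \<theta>)\<close> and \<open>g (y - \<theta>)\<close>.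
\<close>

locale location_model =
  fixes f g :: "'a::euclidean_space \<Rightarrow> real"
  assumes f_measurable [measurable]: "f \<in> borel_measurable borel"
    and g_measurable [measurable]: "g \<in> borel_measurable borel"
    and f_nonneg: "\<And>x. 0 \<le> f x" and g_pos: "\<And>y. 0 < g y"
    and f_prob: "(\<integral>\<^sup>+x. ennreal (f x) \<partial>lborel) = 1"
    and g_prob: "(\<integral>\<^sup>+y. ennreal (g y) \<partial>lborel) = 1"
    and g_bounded: "\<exists>C. \<forall>y. g y \<le> C"
begin

definition p where "p x \<theta> = f (x - \<theta>)"
definition q where "q y \<theta> = g (y - \<theta>)"

text \<open>
  The truncated observation density and the uniform-prior predictive density that it induces for
  the observation 0. The normalisation is needed because truncation loses mass.
\<close>

definition core :: "nat \<Rightarrow> 'a \<Rightarrow> real" where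
  "core k x = f x * indicator (ball 0 (real k)) x"

definition core_predictive :: "nat \<Rightarrow> 'a \<Rightarrow> real" where
  "core_predictive k y = (\<integral>t. core k (- t) * g (y - t) \<partial>lborel) / (\<integral>t. core k (- t) \<partial>lborel)"

definition mre\<^sub>0 :: "'a \<Rightarrow> real" where
  "mre\<^sub>0 y = (\<integral>t. f (- t) * g (y - t) \<partial>lborel)"

lemma core_measurable [measurable]: "core k \<in> borel_measurable borel"
  unfolding core_def by measurable

lemma core_nonneg: "0 \<le> core k x"
  using f_nonneg by (simp add: core_def)

lemma core_le: "core k x \<le> f x"
  using f_nonneg by (simp add: core_def indicator_def)

lemma integrable_reflected:
  assumes [measurable]: "w \<in> borel_measurable borel" and "\<And>x. 0 \<le> w x" "\<And>x. w x \<le> f x"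
  shows "integrable lborel (\<lambda>t. w (x - t))"
proof (rule integrableI_nonneg)
  have "(\<integral>\<^sup>+t. ennreal (w (x - t)) \<partial>lborel) \<le> (\<integral>\<^sup>+t. ennreal (f (x - t)) \<partial>lborel)"
    using assms by (intro nn_integral_mono ennreal_leI)
  also have "\<dots> = 1"
    by (subst nn_integral_lborel_reflect[of "\<lambda>t. ennreal (f t)"]) (simp_all add: f_prob)
  finally show "(\<integral>\<^sup>+t. ennreal (w (x - t)) \<partial>lborel) < \<infinity>"
    by (simp add: order.strict_trans1[OF _ ennreal_one_less_top])
qed (use assms in auto)

lemma integrable_reflected_times_g:
  assumes w: "w \<in> borel_measurable borel" "\<And>x. 0 \<le> w x" "\<And>x. w x \<le> f x"
  shows "integrable lborel (\<lambda>t. w (x - t) * g (y - t))"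
proof -
  obtain C where C: "\<And>y. g y \<le> C"
    using g_bounded by auto
  have [measurable]: "w \<in> borel_measurable borel" by fact
  show ?thesis
  proof (rule Bochner_Integration.integrable_bound)
    show "integrable lborel (\<lambda>t. w (x - t) * C)"
      by (intro integrable_mult_left integrable_reflected assms)
    show "AE t in lborel. norm (w (x - t) * g (y - t)) \<le> norm (w (x - t) * C)"
    proof (intro AE_I2)
      fix t
      have "0 < g (y - t)" "g (y - t) \<le> C" by (auto simp: g_pos C)
      then show "norm (w (x - t) * g (y - t)) \<le> norm (w (x - t) * C)"
        using w(2) by (auto simp: abs_mult intro!: mult_left_mono)
    qed
  qed measurable
qed

lemma mre_pos: "0 < mre\<^sub>0 y"
proof -
  have int: "integrable lborel (\<lambda>t. f (- t) * g (y - t))"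
    using integrable_reflected_times_g[of f 0 y] f_nonneg by simp
  have "mre\<^sub>0 y \<noteq> 0"
  proof
    assume "mre\<^sub>0 y = 0"
    then have "AE t in lborel. f (- t) * g (y - t) = 0"
      unfolding mre\<^sub>0_def using f_nonneg g_pos
      by (subst (asm) integral_nonneg_eq_0_iff_AE[OF int]) (auto simp: less_imp_le)
    then have "AE t in lborel. ennreal (f (- t)) = 0"
      by (rule eventually_mono) (metis less_irrefl mult_eq_0_iff g_pos ennreal_0)
    then have "(\<integral>\<^sup>+t. ennreal (f (0 - t)) \<partial>lborel) = 0"
      by (subst nn_integral_0_iff_AE) auto
    then show False
      by (subst (asm) nn_integral_lborel_reflect[of "\<lambda>t. ennreal (f t)"]) (simp_all add: f_prob)
  qed
  moreover have "0 \<le> mre\<^sub>0 y"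
    unfolding mre\<^sub>0_def using f_nonneg g_pos
    by (intro Bochner_Integration.integral_nonneg) (auto simp: less_imp_le)
  ultimately show ?thesis by simp
qed

lemma core_tendsto: "(\<lambda>k. core k x) \<longlonglongrightarrow> f x"
proof (rule tendsto_eventually)
  obtain n :: nat where "norm x < real n"
    using reals_Archimedean2 by blast
  then show "\<forall>\<^sub>F k in sequentially. core k x = f x"
    by (intro eventually_sequentiallyI[of n]) (auto simp: core_def indicator_def)
qed

lemma core_mass_tendsto: "(\<lambda>k. \<integral>t. core k (- t) \<partial>lborel) \<longlonglongrightarrow> 1"
proof -
  have "(\<lambda>k. \<integral>t. core k (- t) \<partial>lborel) \<longlonglongrightarrow> (\<integral>t. f (- t) \<partial>lborel)"
    using integrable_reflected[of f 0] f_nonneg core_nonneg core_le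
    by (intro integral_dominated_convergence[where w="\<lambda>t. f (- t)"]) (auto simp: core_tendsto)
  moreover have "(\<integral>t. f (- t) \<partial>lborel) = 1"
    using nn_integral_lborel_reflect[of "\<lambda>t. ennreal (f t)" 0] f_nonneg
    by (subst integral_eq_nn_integral) (auto simp: f_prob)
  ultimately show ?thesis by simp
qed

lemma core_predictive_tendsto: "(\<lambda>k. core_predictive k y) \<longlonglongrightarrow> mre\<^sub>0 y"
proof -
  have "(\<lambda>k. \<integral>t. core k (- t) * g (y - t) \<partial>lborel) \<longlonglongrightarrow> mre\<^sub>0 y"
    unfolding mre\<^sub>0_def using integrable_reflected_times_g[of f 0 y] f_nonneg core_nonneg core_le g_pos
    by (intro integral_dominated_convergence[where w="\<lambda>t. f (- t) * g (y - t)"])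
       (auto simp: abs_mult less_imp_le intro!: mult_right_mono tendsto_mult core_tendsto)
  from tendsto_divide[OF this core_mass_tendsto] show ?thesis
    by (simp add: core_predictive_def)
qed

definition core_risk :: "nat \<Rightarrow> ennreal" where
  "core_risk k = (\<integral>\<^sup>+t. \<integral>\<^sup>+y. ennreal (core k (- t)) * kl_term (g (y - t)) (core_predictive k y) \<partial>lborel \<partial>lborel)"

definition mre_risk :: ennreal where
  "mre_risk = (\<integral>\<^sup>+t. \<integral>\<^sup>+y. ennreal (f (- t)) * kl_term (g (y - t)) (mre\<^sub>0 y) \<partial>lborel \<partial>lborel)"

lemma mre_measurable [measurable]: "mre\<^sub>0 \<in> borel_measurable borel"
  "core_predictive k \<in> borel_measurable borel"
  unfolding mre\<^sub>0_def core_predictive_def by measurable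

text \<open>
  Fatou's lemma. The integrands converge because \<open>mre\<^sub>0\<close> is positive, where \<^const>\<open>kl_term\<close> is
  continuous in its second argument.
\<close>

lemma mre_risk_le_liminf: "mre_risk \<le> liminf core_risk"
proof -
  let ?F = "\<lambda>k t y. ennreal (core k (- t)) * kl_term (g (y - t)) (core_predictive k y)"
  have "mre_risk = (\<integral>\<^sup>+t. \<integral>\<^sup>+y. liminf (\<lambda>k. ?F k t y) \<partial>lborel \<partial>lborel)"
    unfolding mre_risk_def
  proof (intro nn_integral_cong)
    fix t y
    have "(\<lambda>k. ?F k t y) \<longlonglongrightarrow> ennreal (f (- t)) * kl_term (g (y - t)) (mre\<^sub>0 y)"
      using g_pos[of "y - t"] mre_pos[of y]
      by (intro tendsto_mult_ennreal tendsto_ennrealI core_tendsto kl_term_tendsto core_predictive_tendsto)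
         (auto simp: kl_term_def)
    then show "ennreal (f (- t)) * kl_term (g (y - t)) (mre\<^sub>0 y) = liminf (\<lambda>k. ?F k t y)"
      using lim_imp_Liminf[OF sequentially_bot] by metis
  qed
  also have "\<dots> \<le> (\<integral>\<^sup>+t. liminf (\<lambda>k. \<integral>\<^sup>+y. ?F k t y \<partial>lborel) \<partial>lborel)"
    by (intro nn_integral_mono nn_integral_liminf) measurable
  also have "\<dots> \<le> liminf core_risk"
    unfolding core_risk_def by (intro nn_integral_liminf) measurable
  finally show ?thesis .
qed

text \<open>
  By translation invariance the truncated risk may be computed at any observation \<open>x\<close>, by
  integrating over the parameter.
\<close>

lemma core_risk_eq: "core_risk k =
   (\<integral>\<^sup>+y. \<integral>\<^sup>+t. ennreal (core k (x - t)) * kl_term (g (y - t)) (core_predictive k (y - x)) \<partial>lborel \<partial>lborel)"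
proof -
  let ?F = "\<lambda>y t. ennreal (core k (- t)) * kl_term (g (y - t)) (core_predictive k y)"
  have "core_risk k = (\<integral>\<^sup>+y. \<integral>\<^sup>+t. ?F y t \<partial>lborel \<partial>lborel)"
    unfolding core_risk_def by (rule lborel_pair.Fubini') measurable
  also have "\<dots> = (\<integral>\<^sup>+y. \<integral>\<^sup>+t. ?F (- x + y) t \<partial>lborel \<partial>lborel)"
    by (rule nn_integral_lborel_shift[symmetric, of "\<lambda>y. \<integral>\<^sup>+t. ?F y t \<partial>lborel"]) measurable
  also have "\<dots> = (\<integral>\<^sup>+y. \<integral>\<^sup>+t. ?F (- x + y) (- x + t) \<partial>lborel \<partial>lborel)"
    by (intro nn_integral_cong nn_integral_lborel_shift[symmetric]) measurable
  finally show ?thesis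
    by (simp add: algebra_simps)
qed

lemma core_predictive_shift:
  "core_predictive k (y - x) = (\<integral>t. core k (x - t) * g (y - t) \<partial>lborel) / (\<integral>t. core k (x - t) \<partial>lborel)"
proof -
  have shift: "(\<integral>t. h t \<partial>lborel) = (\<integral>t. h (- x + t) \<partial>lborel)" if [measurable]: "h \<in> borel_measurable borel" for h :: "'a \<Rightarrow> real"
    by (subst lborel_distr_plus[symmetric, of "- x"]) (simp add: integral_distr)
  show ?thesis
    unfolding core_predictive_def
    using shift[of "\<lambda>t. core k (- t) * g (y - x - t)"] shift[of "\<lambda>t. core k (- t)"]
    by (simp add: algebra_simps)
qed

text \<open>
  For a fixed observation \<open>x\<close>, the posterior mixture is at least as good as any density \<open>r\<close> on average over
  the parameter, pointwise in the predicted value \<open>y\<close>.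
\<close>

lemma core_risk_le:
  assumes r [measurable]: "r \<in> borel_measurable borel" and r_nonneg: "\<And>y. 0 \<le> r y"
    and mass: "0 < (\<integral>t. core k (- t) \<partial>lborel)"
  shows "core_risk k \<le> (\<integral>\<^sup>+t. ennreal (core k (x - t)) * (\<integral>\<^sup>+y. kl_term (g (y - t)) (r y) \<partial>lborel) \<partial>lborel)"
proof -
  obtain C where C: "\<And>y. g y \<le> C"
    using g_bounded by auto
  have m: "(\<integral>t. core k (x - t) \<partial>lborel) = (\<integral>t. core k (- t) \<partial>lborel)"
    by (subst (2) lborel_distr_plus[symmetric, of "- x"]) (simp add: integral_distr algebra_simps)
  have "core_risk k \<le> (\<integral>\<^sup>+y. \<integral>\<^sup>+t. ennreal (core k (x - t)) * kl_term (g (y - t)) (r y) \<partial>lborel \<partial>lborel)"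
    unfolding core_risk_eq[of k x] core_predictive_shift
    by (intro nn_integral_mono kl_term_mixture_le[where C=C] integrable_reflected)
       (auto simp: core_nonneg core_le g_pos C r_nonneg m mass)
  also have "\<dots> = (\<integral>\<^sup>+t. \<integral>\<^sup>+y. ennreal (core k (x - t)) * kl_term (g (y - t)) (r y) \<partial>lborel \<partial>lborel)"
    by (rule lborel_pair.Fubini') measurable
  finally show ?thesis
    by (simp add: nn_integral_cmult)
qed

text \<open>
  If the observation lies in the ball of radius \<open>n\<close> and the error in the ball of radius \<open>k\<close>, then
  the parameter lies in the ball of radius \<open>n + k\<close>. The left-hand side collects only such
  observations and errors; the right-hand side bounds the risk integrated over all parameters in
  the larger ball.
\<close>

lemma ball_core_risk_le:
  assumes r: "predictive_density r" and S: "\<And>\<theta>. kl_ennrisk p q \<theta> r \<le> S"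
    and mass: "0 < (\<integral>t. core k (- t) \<partial>lborel)"
  shows "emeasure lborel (ball (0::'a) (real n)) * core_risk k
       \<le> emeasure lborel (ball (0::'a) (real (n + k))) * S"
proof -
  have [measurable]: "(\<lambda>(y, x). r y x) \<in> borel_measurable (borel \<Otimes>\<^sub>M borel)"
    and r_nonneg: "\<And>y x. 0 \<le> r y x"
    using r by (auto simp: predictive_density_def)
  have [measurable]: "(\<lambda>y. r y x) \<in> borel_measurable borel" for x
    by measurable
  let ?K = "\<lambda>t x. \<integral>\<^sup>+y. kl_term (g (y - t)) (r y x) \<partial>lborel"
  have "emeasure lborel (ball (0::'a) (real n)) * core_risk k
      = (\<integral>\<^sup>+x. indicator (ball (0::'a) (real n)) x * core_risk k \<partial>lborel)"
    by (simp add: nn_integral_multc)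
  also have "\<dots> \<le> (\<integral>\<^sup>+x. indicator (ball 0 (real n)) x * (\<integral>\<^sup>+t. ennreal (core k (x - t)) * ?K t x \<partial>lborel) \<partial>lborel)"
    by (intro nn_integral_mono mult_left_mono core_risk_le r_nonneg mass) auto
  also have "\<dots> = (\<integral>\<^sup>+x. \<integral>\<^sup>+t. indicator (ball 0 (real n)) x * (ennreal (core k (x - t)) * ?K t x) \<partial>lborel \<partial>lborel)"
    by (simp add: nn_integral_cmult)
  also have "\<dots> \<le> (\<integral>\<^sup>+x. \<integral>\<^sup>+t. indicator (ball 0 (real (n + k))) t * (ennreal (f (x - t)) * ?K t x) \<partial>lborel \<partial>lborel)"
  proof (intro nn_integral_mono)
    fix x t :: 'a
    have "t \<in> ball 0 (real (n + k))" if "x \<in> ball 0 (real n)" "x - t \<in> ball 0 (real k)"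
      using that norm_triangle_ineq4[of x "x - t"] by auto
    then show "indicator (ball 0 (real n)) x * (ennreal (core k (x - t)) * ?K t x)
        \<le> indicator (ball 0 (real (n + k))) t * (ennreal (f (x - t)) * ?K t x)"
      by (auto simp: core_def indicator_def)
  qed
  also have "\<dots> = (\<integral>\<^sup>+t. \<integral>\<^sup>+x. indicator (ball 0 (real (n + k))) t * (ennreal (f (x - t)) * ?K t x) \<partial>lborel \<partial>lborel)"
    by (rule lborel_pair.Fubini') measurable
  also have "\<dots> = (\<integral>\<^sup>+t. indicator (ball 0 (real (n + k))) t * kl_ennrisk p q t r \<partial>lborel)"
    by (simp add: nn_integral_cmult kl_ennrisk_def p_def q_def)
  also have "\<dots> \<le> (\<integral>\<^sup>+t. indicator (ball (0::'a) (real (n + k))) t * S \<partial>lborel)"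
    by (intro nn_integral_mono mult_left_mono S) auto
  also have "\<dots> = emeasure lborel (ball (0::'a) (real (n + k))) * S"
    by (simp add: nn_integral_multc)
  finally show ?thesis .
qed

lemma mre_risk_le:
  assumes r: "predictive_density r" and S: "\<And>\<theta>. kl_ennrisk p q \<theta> r \<le> S"
  shows "mre_risk \<le> S"
proof (cases "S = top")
  case False
  have core: "core_risk k \<le> S" if mass: "0 < (\<integral>t. core k (- t) \<partial>lborel)" for k
  proof -
    let ?d = "DIM('a)"
    have "core_risk k \<le> ennreal (((n + k) / n) ^ ?d) * S" if n: "0 < n" for n :: nat
    proof -
      define v where "v = unit_ball_vol (real ?d)"
      have v: "0 < v" by (simp add: v_def)
      have nn: "0 < v * real n ^ ?d" using v n by simp
      have "ennreal (v * real n ^ ?d) * core_risk k \<le> ennreal (v * real (n + k) ^ ?d) * S"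
        using ball_core_risk_le[OF r S mass, of n] by (simp add: emeasure_ball v_def)
      also have "v * real (n + k) ^ ?d = v * real n ^ ?d * (((n + k) / n) ^ ?d)"
        using n by (simp add: power_divide)
      also have "ennreal \<dots> * S = ennreal (v * real n ^ ?d) * (ennreal (((n + k) / n) ^ ?d) * S)"
        using nn by (subst ennreal_mult) (auto simp: mult.assoc)
      finally show ?thesis
        using nn by (subst (asm) ennreal_mult_le_mult_iff) (auto simp: ennreal_eq_0_iff)
    qed
    moreover have "(\<lambda>n::nat. ennreal (((n + k) / n) ^ ?d) * S) \<longlonglongrightarrow> ennreal (1 ^ ?d) * S"
    proof -
      have "(\<lambda>n::nat. 1 + real k / real n) \<longlonglongrightarrow> 1"
        using tendsto_add[OF tendsto_const[of 1] lim_const_over_n[of "real k"]] by simp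
      then have "(\<lambda>n::nat. (real n + real k) / real n) \<longlonglongrightarrow> 1"
        by (rule Lim_transform_eventually[where f="\<lambda>n::nat. 1 + real k / real n"])
           (auto intro!: eventually_sequentiallyI[of 1] simp: field_simps)
      then show ?thesis
        using False by (intro tendsto_mult_ennreal tendsto_ennrealI tendsto_power) auto
    qed
    ultimately show ?thesis
      by (intro LIMSEQ_le_const[where X="\<lambda>n::nat. ennreal (((n + k) / n) ^ ?d) * S"]) (auto intro!: exI[of _ 1])
  qed
  have "\<forall>\<^sub>F k in sequentially. core_risk k \<le> S"
    using order_tendstoD(1)[OF core_mass_tendsto, of 0] by (rule eventually_mono) (auto intro: core)
  then have "liminf core_risk \<le> S"
    by (intro Liminf_le) auto
  then show ?thesis
    using mre_risk_le_liminf by simp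
qed simp

lemma mre_predictive_eq: "mre_predictive p q y x = mre\<^sub>0 (y - x)"
proof -
  have "(\<integral>t. f (x - t) \<partial>lborel) = 1"
    using nn_integral_lborel_reflect[of "\<lambda>t. ennreal (f t)" x] f_nonneg
    by (subst integral_eq_nn_integral) (auto simp: f_prob)
  moreover have "mre\<^sub>0 (y - x) = (\<integral>t. f (x - t) * g (y - t) \<partial>lborel)"
    unfolding mre\<^sub>0_def
    by (subst (2) lborel_distr_plus[symmetric, of "x"]) (simp add: integral_distr algebra_simps)
  ultimately show ?thesis
    by (simp add: mre_predictive_def bayes_predictive_def posterior_pdf_def p_def q_def mult.commute)
qed

lemma kl_ennrisk_mre: "kl_ennrisk p q \<theta> (mre_predictive p q) = mre_risk"
proof -
  let ?K = "\<lambda>x. \<integral>\<^sup>+y. kl_term (g (y - \<theta>)) (mre\<^sub>0 (y - x)) \<partial>lborel"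
  have "kl_ennrisk p q \<theta> (mre_predictive p q) = (\<integral>\<^sup>+x. ennreal (f (x - \<theta>)) * ?K x \<partial>lborel)"
    by (simp add: kl_ennrisk_def mre_predictive_eq p_def q_def)
  also have "\<dots> = (\<integral>\<^sup>+t. ennreal (f (\<theta> - t - \<theta>)) * ?K (\<theta> - t) \<partial>lborel)"
    by (rule nn_integral_lborel_reflect[symmetric, of "\<lambda>x. ennreal (f (x - \<theta>)) * ?K x"]) measurable
  also have "\<dots> = (\<integral>\<^sup>+t. ennreal (f (- t)) * (\<integral>\<^sup>+y. kl_term (g (y - t)) (mre\<^sub>0 y) \<partial>lborel) \<partial>lborel)"
  proof (rule nn_integral_cong)
    fix t
    have "?K (\<theta> - t) = (\<integral>\<^sup>+y. kl_term (g (y - t)) (mre\<^sub>0 y) \<partial>lborel)"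
      using nn_integral_lborel_shift[of "\<lambda>y. kl_term (g (y - \<theta>)) (mre\<^sub>0 (y - (\<theta> - t)))" "\<theta> - t"]
      by (simp add: algebra_simps)
    moreover have "\<theta> - t - \<theta> = - t"
      by simp
    ultimately show "ennreal (f (\<theta> - t - \<theta>)) * ?K (\<theta> - t)
        = ennreal (f (- t)) * (\<integral>\<^sup>+y. kl_term (g (y - t)) (mre\<^sub>0 y) \<partial>lborel)"
      by (simp only:)
  qed
  finally show ?thesis
    by (simp add: mre_risk_def nn_integral_cmult)
qed

lemma regular_location: "regular_density (\<lambda>y \<theta>. g (y - \<theta>))"
proof -
  have "(\<integral>\<^sup>+y. ennreal (g (y - \<theta>)) \<partial>lborel) = 1" for \<theta>
    using nn_integral_lborel_shift[of "\<lambda>y. ennreal (g y)" "- \<theta>"] by (simp add: g_prob)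
  then show ?thesis
    using g_bounded g_pos by (auto simp: regular_density_def)
qed

text \<open>
  The MRE predictive density has constant risk, so the lower bound for the maximal risk of any
  predictive density is its own maximal risk.
\<close>

lemma minimax_mre:
  assumes p: "regular_density p"
  shows "minimax p q (mre_predictive p q)"
proof -
  have q: "regular_density q"
    using regular_location by (simp add: q_def[abs_def])
  have "(\<integral>\<^sup>+t. ennreal (p x t * 1) \<partial>lborel) = 1" for x
    using nn_integral_lborel_reflect[of "\<lambda>t. ennreal (f t)" x] by (simp add: p_def f_prob)
  then have "posterior_well_defined p (\<lambda>_. 1)"
    by (simp add: posterior_well_defined_def)
  then have mre: "predictive_density (mre_predictive p q)"
    unfolding mre_predictive_def by (intro predictive_density_bayes p q) auto
  show ?thesis
    unfolding minimax_def
  proof (intro conjI allI impI mre)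
    fix r :: "'a \<Rightarrow> 'a \<Rightarrow> real"
    assume r: "predictive_density r"
    let ?S = "SUP \<theta>. kl_risk p q \<theta> r"
    have le: "enn2ereal (kl_ennrisk p q \<theta> r) \<le> ?S" for \<theta>
      unfolding kl_risk_regular[OF p q r] by (rule SUP_upper) simp
    have S: "enn2ereal (e2ennreal ?S) = ?S"
      by (intro enn2ereal_e2ennreal order_trans[OF enn2ereal_nonneg le])
    have "kl_ennrisk p q \<theta> r \<le> e2ennreal ?S" for \<theta>
      using le S by (metis enn2ereal_le_iff)
    then have "mre_risk \<le> e2ennreal ?S"
      by (rule mre_risk_le[OF r])
    then have "enn2ereal mre_risk \<le> ?S"
      using S by (metis enn2ereal_le_iff)
    then show "(SUP \<theta>. kl_risk p q \<theta> (mre_predictive p q)) \<le> ?S"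
      unfolding kl_risk_regular[OF p q mre] kl_ennrisk_mre by simp
  qed
qed

end

section \<open>Models that split into two independent factors\<close>

text \<open>
  A model on \<open>'a\<close> that the coordinate maps \<open>c\<^sub>1\<close> and \<open>c\<^sub>2\<close> turn into a product of two models. The maps are
  abstract so that one locale serves the plain splitting of coordinates and the splitting after a
  rotation. The last assumption says that the uniform prior is proper a posteriori in the first factor.
\<close>

locale product_model =
  fixes c\<^sub>1 :: "'a::euclidean_space \<Rightarrow> 'b::euclidean_space" and c\<^sub>2 :: "'a \<Rightarrow> 'c::euclidean_space"
    and p q :: "'a \<Rightarrow> 'a \<Rightarrow> real"
    and p\<^sub>1 q\<^sub>1 :: "'b \<Rightarrow> 'b \<Rightarrow> real" and p\<^sub>2 q\<^sub>2 :: "'c \<Rightarrow> 'c \<Rightarrow> real"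
  assumes c_measurable [measurable]: "c\<^sub>1 \<in> borel_measurable borel" "c\<^sub>2 \<in> borel_measurable borel"
    and c_surj: "\<exists>x. c\<^sub>1 x = a \<and> c\<^sub>2 x = b"
    and nn_integral_c: "h \<in> borel_measurable (borel \<Otimes>\<^sub>M borel) \<Longrightarrow>
      (\<integral>\<^sup>+x. h (c\<^sub>1 x, c\<^sub>2 x) \<partial>lborel) = (\<integral>\<^sup>+a. \<integral>\<^sup>+b. h (a, b) \<partial>lborel \<partial>lborel)"
    and regular: "regular_density p\<^sub>1" "regular_density q\<^sub>1" "regular_density p\<^sub>2" "regular_density q\<^sub>2"
      "regular_density p" "regular_density q"
    and p_prod: "p x \<theta> = p\<^sub>1 (c\<^sub>1 x) (c\<^sub>1 \<theta>) * p\<^sub>2 (c\<^sub>2 x) (c\<^sub>2 \<theta>)"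
    and q_prod: "q x \<theta> = q\<^sub>1 (c\<^sub>1 x) (c\<^sub>1 \<theta>) * q\<^sub>2 (c\<^sub>2 x) (c\<^sub>2 \<theta>)"
    and p\<^sub>1_flat: "(\<integral>\<^sup>+\<theta>. ennreal (p\<^sub>1 a \<theta>) \<partial>lborel) = 1"
begin

lemmas [measurable] = regular(1-4)[THEN regular_density_measurable_comp]

lemma pos: "0 < p\<^sub>1 a a'" "0 < q\<^sub>1 a a'" "0 < p\<^sub>2 b b'" "0 < q\<^sub>2 b b'"
  using regular by (auto intro: regular_density_pos)

lemma nn_integral_c_mult:
  assumes [measurable]: "u \<in> borel_measurable borel" "v \<in> borel_measurable borel"
  shows "(\<integral>\<^sup>+x. u (c\<^sub>1 x) * v (c\<^sub>2 x) \<partial>lborel) = (\<integral>\<^sup>+a. u a \<partial>lborel) * (\<integral>\<^sup>+b. v b \<partial>lborel)"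
  using nn_integral_c[of "\<lambda>(a, b). u a * v b"]
  by (simp add: nn_integral_cmult nn_integral_multc)

text \<open>
  The prior depends on the second coordinate only; the first factor of the density integrates
  to 1 against the flat prior.
\<close>

lemma posterior_norm:
  assumes [measurable]: "\<pi>\<^sub>0 \<in> borel_measurable borel" and \<pi>\<^sub>0: "\<And>z. 0 \<le> \<pi>\<^sub>0 z"
  shows "(\<integral>\<^sup>+\<theta>. ennreal (p x \<theta> * \<pi>\<^sub>0 (c\<^sub>2 \<theta>)) \<partial>lborel)
       = (\<integral>\<^sup>+b. ennreal (p\<^sub>2 (c\<^sub>2 x) b * \<pi>\<^sub>0 b) \<partial>lborel)"
proof -
  have "(\<integral>\<^sup>+\<theta>. ennreal (p x \<theta> * \<pi>\<^sub>0 (c\<^sub>2 \<theta>)) \<partial>lborel)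
      = (\<integral>\<^sup>+\<theta>. ennreal (p\<^sub>1 (c\<^sub>1 x) (c\<^sub>1 \<theta>)) * ennreal (p\<^sub>2 (c\<^sub>2 x) (c\<^sub>2 \<theta>) * \<pi>\<^sub>0 (c\<^sub>2 \<theta>)) \<partial>lborel)"
    using pos \<pi>\<^sub>0 by (simp add: p_prod ennreal_mult less_imp_le mult.assoc)
  also have "\<dots> = (\<integral>\<^sup>+b. ennreal (p\<^sub>2 (c\<^sub>2 x) b * \<pi>\<^sub>0 b) \<partial>lborel)"
    by (subst nn_integral_c_mult[of "\<lambda>a. ennreal (p\<^sub>1 (c\<^sub>1 x) a)" "\<lambda>b. ennreal (p\<^sub>2 (c\<^sub>2 x) b * \<pi>\<^sub>0 b)"])
       (simp_all add: p\<^sub>1_flat)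
  finally show ?thesis .
qed

lemma posterior_well_defined_iff:
  assumes "\<pi>\<^sub>0 \<in> borel_measurable borel" "\<And>z. 0 \<le> \<pi>\<^sub>0 z"
  shows "posterior_well_defined p (\<lambda>\<theta>. \<pi>\<^sub>0 (c\<^sub>2 \<theta>)) \<longleftrightarrow> posterior_well_defined p\<^sub>2 \<pi>\<^sub>0"
  unfolding posterior_well_defined_def posterior_norm[OF assms] using c_surj by metis

lemma bayes_predictive_product:
  assumes [measurable]: "\<pi>\<^sub>0 \<in> borel_measurable borel" and \<pi>\<^sub>0: "\<And>z. 0 \<le> \<pi>\<^sub>0 z"
  shows "bayes_predictive p q (\<lambda>\<theta>. \<pi>\<^sub>0 (c\<^sub>2 \<theta>)) y x
       = mre_predictive p\<^sub>1 q\<^sub>1 (c\<^sub>1 y) (c\<^sub>1 x) * bayes_predictive p\<^sub>2 q\<^sub>2 \<pi>\<^sub>0 (c\<^sub>2 y) (c\<^sub>2 x)"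
proof -
  have "(\<integral>\<^sup>+\<theta>. ennreal (q y \<theta> * (p x \<theta> * \<pi>\<^sub>0 (c\<^sub>2 \<theta>))) \<partial>lborel)
      = (\<integral>\<^sup>+\<theta>. ennreal (q\<^sub>1 (c\<^sub>1 y) (c\<^sub>1 \<theta>) * p\<^sub>1 (c\<^sub>1 x) (c\<^sub>1 \<theta>))
            * ennreal (q\<^sub>2 (c\<^sub>2 y) (c\<^sub>2 \<theta>) * (p\<^sub>2 (c\<^sub>2 x) (c\<^sub>2 \<theta>) * \<pi>\<^sub>0 (c\<^sub>2 \<theta>))) \<partial>lborel)"
    using pos \<pi>\<^sub>0 by (simp add: p_prod q_prod less_imp_le ac_simps flip: ennreal_mult)
  also have "\<dots> = (\<integral>\<^sup>+a. ennreal (q\<^sub>1 (c\<^sub>1 y) a * p\<^sub>1 (c\<^sub>1 x) a) \<partial>lborel)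
      * (\<integral>\<^sup>+b. ennreal (q\<^sub>2 (c\<^sub>2 y) b * (p\<^sub>2 (c\<^sub>2 x) b * \<pi>\<^sub>0 b)) \<partial>lborel)"
    by (rule nn_integral_c_mult[of "\<lambda>a. ennreal (q\<^sub>1 (c\<^sub>1 y) a * p\<^sub>1 (c\<^sub>1 x) a)"
          "\<lambda>b. ennreal (q\<^sub>2 (c\<^sub>2 y) b * (p\<^sub>2 (c\<^sub>2 x) b * \<pi>\<^sub>0 b))"]) measurable
  finally have num: "(\<integral>\<^sup>+\<theta>. ennreal (q y \<theta> * (p x \<theta> * \<pi>\<^sub>0 (c\<^sub>2 \<theta>))) \<partial>lborel) = \<dots>" .
  show ?thesis
    unfolding mre_predictive_def
    using \<pi>\<^sub>0 by (simp add: bayes_predictive_eq_ratio regular num posterior_norm enn2real_mult p\<^sub>1_flat)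
qed

lemma kl_ennrisk_product:
  assumes r\<^sub>1: "predictive_density r\<^sub>1" and r\<^sub>2: "predictive_density r\<^sub>2"
  shows "kl_ennrisk p q \<theta> (\<lambda>y x. r\<^sub>1 (c\<^sub>1 y) (c\<^sub>1 x) * r\<^sub>2 (c\<^sub>2 y) (c\<^sub>2 x))
       = kl_ennrisk p\<^sub>1 q\<^sub>1 (c\<^sub>1 \<theta>) r\<^sub>1 + kl_ennrisk p\<^sub>2 q\<^sub>2 (c\<^sub>2 \<theta>) r\<^sub>2"
proof -
  have [measurable]: "(\<lambda>(y, x). r\<^sub>1 y x) \<in> borel_measurable (borel \<Otimes>\<^sub>M borel)"
      "(\<lambda>(y, x). r\<^sub>2 y x) \<in> borel_measurable (borel \<Otimes>\<^sub>M borel)"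
    and r_nonneg: "\<And>y x. 0 \<le> r\<^sub>1 y x" "\<And>y x. 0 \<le> r\<^sub>2 y x"
    and r_prob: "\<And>x. (\<integral>\<^sup>+y. ennreal (r\<^sub>1 y x) \<partial>lborel) = 1" "\<And>x. (\<integral>\<^sup>+y. ennreal (r\<^sub>2 y x) \<partial>lborel) = 1"
    using r\<^sub>1 r\<^sub>2 by (auto simp: predictive_density_def)
  let ?t\<^sub>1 = "c\<^sub>1 \<theta>" and ?t\<^sub>2 = "c\<^sub>2 \<theta>"
  let ?K\<^sub>1 = "\<lambda>a. \<integral>\<^sup>+y. kl_term (q\<^sub>1 y ?t\<^sub>1) (r\<^sub>1 y a) \<partial>lborel"
  let ?K\<^sub>2 = "\<lambda>b. \<integral>\<^sup>+y. kl_term (q\<^sub>2 y ?t\<^sub>2) (r\<^sub>2 y b) \<partial>lborel"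
  have loss: "(\<integral>\<^sup>+y. kl_term (q y \<theta>) (r\<^sub>1 (c\<^sub>1 y) a * r\<^sub>2 (c\<^sub>2 y) b) \<partial>lborel) = ?K\<^sub>1 a + ?K\<^sub>2 b" for a b
  proof -
    have "(\<integral>\<^sup>+y. kl_term (q y \<theta>) (r\<^sub>1 (c\<^sub>1 y) a * r\<^sub>2 (c\<^sub>2 y) b) \<partial>lborel)
        = (\<integral>\<^sup>+u. \<integral>\<^sup>+v. kl_term (q\<^sub>1 u ?t\<^sub>1 * q\<^sub>2 v ?t\<^sub>2) (r\<^sub>1 u a * r\<^sub>2 v b) \<partial>lborel \<partial>lborel)"
      using nn_integral_c[of "\<lambda>(u, v). kl_term (q\<^sub>1 u ?t\<^sub>1 * q\<^sub>2 v ?t\<^sub>2) (r\<^sub>1 u a * r\<^sub>2 v b)"]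
      by (simp add: q_prod)
    also have "\<dots> = ?K\<^sub>1 a + ?K\<^sub>2 b"
      by (rule kl_divergence_product) (use pos r_nonneg r_prob regular in \<open>auto simp: less_imp_le regular_density_prob\<close>)
    finally show ?thesis .
  qed
  have "kl_ennrisk p q \<theta> (\<lambda>y x. r\<^sub>1 (c\<^sub>1 y) (c\<^sub>1 x) * r\<^sub>2 (c\<^sub>2 y) (c\<^sub>2 x))
      = (\<integral>\<^sup>+x. ennreal (p\<^sub>1 (c\<^sub>1 x) ?t\<^sub>1) * ennreal (p\<^sub>2 (c\<^sub>2 x) ?t\<^sub>2) * (?K\<^sub>1 (c\<^sub>1 x) + ?K\<^sub>2 (c\<^sub>2 x)) \<partial>lborel)"
    using pos by (simp add: kl_ennrisk_def loss p_prod ennreal_mult less_imp_le)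
  also have "\<dots> = (\<integral>\<^sup>+a. \<integral>\<^sup>+b. ennreal (p\<^sub>1 a ?t\<^sub>1) * ennreal (p\<^sub>2 b ?t\<^sub>2) * (?K\<^sub>1 a + ?K\<^sub>2 b) \<partial>lborel \<partial>lborel)"
    using nn_integral_c[of "\<lambda>(a, b). ennreal (p\<^sub>1 a ?t\<^sub>1) * ennreal (p\<^sub>2 b ?t\<^sub>2) * (?K\<^sub>1 a + ?K\<^sub>2 b)"]
    by simp
  also have "\<dots> = (\<integral>\<^sup>+a. \<integral>\<^sup>+b. (ennreal (p\<^sub>1 a ?t\<^sub>1) * ?K\<^sub>1 a) * ennreal (p\<^sub>2 b ?t\<^sub>2)
        + ennreal (p\<^sub>1 a ?t\<^sub>1) * (ennreal (p\<^sub>2 b ?t\<^sub>2) * ?K\<^sub>2 b) \<partial>lborel \<partial>lborel)"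
    by (simp add: distrib_left ac_simps)
  also have "\<dots> = (\<integral>\<^sup>+a. (ennreal (p\<^sub>1 a ?t\<^sub>1) * ?K\<^sub>1 a) + ennreal (p\<^sub>1 a ?t\<^sub>1) * kl_ennrisk p\<^sub>2 q\<^sub>2 ?t\<^sub>2 r\<^sub>2 \<partial>lborel)"
    by (simp add: nn_integral_add nn_integral_cmult kl_ennrisk_def regular_density_prob[OF regular(3)])
  also have "\<dots> = kl_ennrisk p\<^sub>1 q\<^sub>1 ?t\<^sub>1 r\<^sub>1 + kl_ennrisk p\<^sub>2 q\<^sub>2 ?t\<^sub>2 r\<^sub>2"
    by (simp add: nn_integral_add nn_integral_multc kl_ennrisk_def regular_density_prob[OF regular(1)])
  finally show ?thesis .
qed

text \<open>
  The common factor \<open>r\<^sub>1\<close> contributes the same summand to both risks. A finite risk at one parameter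
  makes this summand finite there, and the second coordinate of the parameter can be varied
  without changing it, so that it cancels in every comparison.
\<close>

lemma dominates_iff:
  assumes r\<^sub>1: "predictive_density r\<^sub>1" and r\<^sub>2: "predictive_density r\<^sub>2" and s\<^sub>2: "predictive_density s\<^sub>2"
    and r: "predictive_density r" "\<And>y x. r y x = r\<^sub>1 (c\<^sub>1 y) (c\<^sub>1 x) * r\<^sub>2 (c\<^sub>2 y) (c\<^sub>2 x)"
    and s: "predictive_density s" "\<And>y x. s y x = r\<^sub>1 (c\<^sub>1 y) (c\<^sub>1 x) * s\<^sub>2 (c\<^sub>2 y) (c\<^sub>2 x)"
    and fin: "kl_risk p q \<theta>\<^sub>0 r < \<infinity> \<or> kl_risk p q \<theta>\<^sub>0 s < \<infinity>"
  shows "dominates p q r s \<longleftrightarrow> dominates p\<^sub>2 q\<^sub>2 r\<^sub>2 s\<^sub>2"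
proof -
  let ?A = "\<lambda>\<theta>. kl_ennrisk p\<^sub>1 q\<^sub>1 (c\<^sub>1 \<theta>) r\<^sub>1"
  let ?R = "\<lambda>b. kl_ennrisk p\<^sub>2 q\<^sub>2 b r\<^sub>2" and ?S = "\<lambda>b. kl_ennrisk p\<^sub>2 q\<^sub>2 b s\<^sub>2"
  have req: "r = (\<lambda>y x. r\<^sub>1 (c\<^sub>1 y) (c\<^sub>1 x) * r\<^sub>2 (c\<^sub>2 y) (c\<^sub>2 x))"
    and seq: "s = (\<lambda>y x. r\<^sub>1 (c\<^sub>1 y) (c\<^sub>1 x) * s\<^sub>2 (c\<^sub>2 y) (c\<^sub>2 x))"
    using r(2) s(2) by (simp_all add: fun_eq_iff)
  have R: "kl_risk p q \<theta> r = enn2ereal (?A \<theta> + ?R (c\<^sub>2 \<theta>))" for \<theta>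
    using kl_risk_regular[OF regular(5,6) r(1)] kl_ennrisk_product[OF r\<^sub>1 r\<^sub>2] req by simp
  have S: "kl_risk p q \<theta> s = enn2ereal (?A \<theta> + ?S (c\<^sub>2 \<theta>))" for \<theta>
    using kl_risk_regular[OF regular(5,6) s(1)] kl_ennrisk_product[OF r\<^sub>1 s\<^sub>2] seq by simp
  have A: "?A \<theta>\<^sub>0 < top"
    using fin unfolding R S
    by (auto simp: enn2ereal_less_infty_iff less_top)
  \<comment> \<open>parameters with the first coordinate of \<open>\<theta>\<^sub>0\<close> and an arbitrary second one\<close>
  obtain w where w: "c\<^sub>1 (w b) = c\<^sub>1 \<theta>\<^sub>0" "c\<^sub>2 (w b) = b" for b
    using c_surj[of "c\<^sub>1 \<theta>\<^sub>0"] by metis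
  have le: "?A \<theta>\<^sub>0 + u \<le> ?A \<theta>\<^sub>0 + v \<longleftrightarrow> u \<le> v" and less: "?A \<theta>\<^sub>0 + u < ?A \<theta>\<^sub>0 + v \<longleftrightarrow> u < v" for u v
    using A by (auto simp: ennreal_add_left_cancel_le ennreal_add_left_cancel_less)
  show ?thesis
    unfolding dominates_def R S kl_risk_regular[OF regular(3,4) r\<^sub>2] kl_risk_regular[OF regular(3,4) s\<^sub>2]
      enn2ereal_le_iff enn2ereal_less_iff
  proof (intro iffI conjI allI)
    fix b assume "(\<forall>\<theta>. ?A \<theta> + ?R (c\<^sub>2 \<theta>) \<le> ?A \<theta> + ?S (c\<^sub>2 \<theta>)) \<and> (\<exists>\<theta>. ?A \<theta> + ?R (c\<^sub>2 \<theta>) < ?A \<theta> + ?S (c\<^sub>2 \<theta>))"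
    then have "?A (w b) + ?R (c\<^sub>2 (w b)) \<le> ?A (w b) + ?S (c\<^sub>2 (w b))"
      by blast
    then show "?R b \<le> ?S b"
      unfolding w le .
  next
    assume "(\<forall>\<theta>. ?A \<theta> + ?R (c\<^sub>2 \<theta>) \<le> ?A \<theta> + ?S (c\<^sub>2 \<theta>)) \<and> (\<exists>\<theta>. ?A \<theta> + ?R (c\<^sub>2 \<theta>) < ?A \<theta> + ?S (c\<^sub>2 \<theta>))"
    then obtain \<theta> where "?A \<theta> + ?R (c\<^sub>2 \<theta>) < ?A \<theta> + ?S (c\<^sub>2 \<theta>)"
      by blast
    then have "\<not> ?S (c\<^sub>2 \<theta>) \<le> ?R (c\<^sub>2 \<theta>)"
      by (meson add_left_mono leD)
    then show "\<exists>b. ?R b < ?S b"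
      using not_le by blast
  next
    fix \<theta> assume "(\<forall>b. ?R b \<le> ?S b) \<and> (\<exists>b. ?R b < ?S b)"
    then show "?A \<theta> + ?R (c\<^sub>2 \<theta>) \<le> ?A \<theta> + ?S (c\<^sub>2 \<theta>)"
      by (intro add_left_mono) simp
  next
    assume "(\<forall>b. ?R b \<le> ?S b) \<and> (\<exists>b. ?R b < ?S b)"
    then obtain b where "?R b < ?S b" by blast
    then have "?A (w b) + ?R (c\<^sub>2 (w b)) < ?A (w b) + ?S (c\<^sub>2 (w b))"
      unfolding w less .
    then show "\<exists>\<theta>. ?A \<theta> + ?R (c\<^sub>2 \<theta>) < ?A \<theta> + ?S (c\<^sub>2 \<theta>)" ..
  qed
qed

lemma distr_c:
  shows distr_c\<^sub>1: "distr (density lborel (\<lambda>x. ennreal (p x \<theta>))) borel c\<^sub>1 = density lborel (\<lambda>a. ennreal (p\<^sub>1 a (c\<^sub>1 \<theta>)))"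
    and distr_c\<^sub>2: "distr (density lborel (\<lambda>x. ennreal (p x \<theta>))) borel c\<^sub>2 = density lborel (\<lambda>b. ennreal (p\<^sub>2 b (c\<^sub>2 \<theta>)))"
proof -
  have em: "emeasure (distr (density lborel (\<lambda>x. ennreal (p x \<theta>))) borel c) A
      = (\<integral>\<^sup>+x. ennreal (p\<^sub>1 (c\<^sub>1 x) (c\<^sub>1 \<theta>)) * ennreal (p\<^sub>2 (c\<^sub>2 x) (c\<^sub>2 \<theta>)) * indicator A (c x) \<partial>lborel)"
    if [measurable]: "c \<in> borel_measurable borel" "A \<in> sets borel" for c :: "'a \<Rightarrow> 'd::euclidean_space" and A
  proof -
    have "c -` A \<in> sets borel"
      using measurable_sets[OF that] by simp
    then show ?thesis
      using pos by (simp add: emeasure_distr emeasure_density p_prod ennreal_mult less_imp_le indicator_def)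
  qed
  show "distr (density lborel (\<lambda>x. ennreal (p x \<theta>))) borel c\<^sub>1 = density lborel (\<lambda>a. ennreal (p\<^sub>1 a (c\<^sub>1 \<theta>)))"
  proof (rule measure_eqI)
    fix A assume "A \<in> sets (distr (density lborel (\<lambda>x. ennreal (p x \<theta>))) borel c\<^sub>1)"
    then have [measurable]: "A \<in> sets borel" by simp
    show "emeasure (distr (density lborel (\<lambda>x. ennreal (p x \<theta>))) borel c\<^sub>1) A
        = emeasure (density lborel (\<lambda>a. ennreal (p\<^sub>1 a (c\<^sub>1 \<theta>)))) A"
      using nn_integral_c_mult[of "\<lambda>a. ennreal (p\<^sub>1 a (c\<^sub>1 \<theta>)) * indicator A a" "\<lambda>b. ennreal (p\<^sub>2 b (c\<^sub>2 \<theta>))"]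
      by (simp add: em emeasure_density regular_density_prob[OF regular(3)] ac_simps)
  qed simp
  show "distr (density lborel (\<lambda>x. ennreal (p x \<theta>))) borel c\<^sub>2 = density lborel (\<lambda>b. ennreal (p\<^sub>2 b (c\<^sub>2 \<theta>)))"
  proof (rule measure_eqI)
    fix A assume "A \<in> sets (distr (density lborel (\<lambda>x. ennreal (p x \<theta>))) borel c\<^sub>2)"
    then have [measurable]: "A \<in> sets borel" by simp
    show "emeasure (distr (density lborel (\<lambda>x. ennreal (p x \<theta>))) borel c\<^sub>2) A
        = emeasure (density lborel (\<lambda>b. ennreal (p\<^sub>2 b (c\<^sub>2 \<theta>)))) A"
      using nn_integral_c_mult[of "\<lambda>a. ennreal (p\<^sub>1 a (c\<^sub>1 \<theta>))" "\<lambda>b. ennreal (p\<^sub>2 b (c\<^sub>2 \<theta>)) * indicator A b"]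
      by (simp add: em emeasure_density regular_density_prob[OF regular(1)] ac_simps)
  qed simp
qed

text \<open>
  Lebesgue measure is invariant under \<open>T\<close>, so coordinates that split it still do so after \<open>T\<close>.
\<close>

lemma product_model_orthogonal:
  fixes T :: "'a \<Rightarrow> 'a"
  assumes T: "orthogonal_transformation T" and [measurable]: "T \<in> borel_measurable borel"
    and p': "\<And>x \<theta>. p' x \<theta> = p (T x) (T \<theta>)" "regular_density p'"
    and q': "\<And>x \<theta>. q' x \<theta> = q (T x) (T \<theta>)" "regular_density q'"
  shows "product_model (\<lambda>x. c\<^sub>1 (T x)) (\<lambda>x. c\<^sub>2 (T x)) p' q' p\<^sub>1 q\<^sub>1 p\<^sub>2 q\<^sub>2"
proof
  show "\<exists>x. c\<^sub>1 (T x) = a \<and> c\<^sub>2 (T x) = b" for a b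
    using c_surj[of a b] bij_is_surj[OF orthogonal_transformation_bij[OF T]] by (metis surjD)
  show "(\<integral>\<^sup>+x. h (c\<^sub>1 (T x), c\<^sub>2 (T x)) \<partial>lborel) = (\<integral>\<^sup>+a. \<integral>\<^sup>+b. h (a, b) \<partial>lborel \<partial>lborel)"
    if [measurable]: "h \<in> borel_measurable (borel \<Otimes>\<^sub>M borel)" for h
    using nn_integral_lborel_orthogonal[OF T, of "\<lambda>x. h (c\<^sub>1 x, c\<^sub>2 x)"] nn_integral_c[OF that] by simp
qed (use regular p' q' p_prod q_prod p\<^sub>1_flat in auto)

end

section \<open>Normal densities and their mean mixtures\<close>

lemma mvn_pdf_mat_pos: "0 < s \<Longrightarrow> 0 < mvn_pdf (mat s) x (\<mu> :: real ^ 'n::finite)"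
  by (simp add: mvn_pdf_mat)

lemma mvn_pdf_mat_le: "0 < s \<Longrightarrow> mvn_pdf (mat s) x (\<mu> :: real ^ 'n::finite) \<le> 1 / sqrt ((2 * pi * s) ^ CARD('n))"
  by (simp add: mvn_pdf_mat divide_right_mono)

lemma regular_density_mvn:
  assumes s: "0 < s"
  shows "regular_density (mvn_pdf (mat s :: real ^ 'n::finite ^ 'n))"
proof -
  note [measurable] = borel_measurable_mvn_pdf_mat[OF s]
  have "(\<integral>\<^sup>+x. ennreal (mvn_pdf (mat s) x \<mu>) \<partial>lborel) = 1" for \<mu> :: "real ^ 'n"
    using prob_space.emeasure_space_1[OF prob_space_mvn_mat[OF s, of \<mu>]]
    by (simp add: mvn_def emeasure_density)
  moreover have "(\<lambda>(x, \<mu>). mvn_pdf (mat s :: real ^ 'n ^ 'n) x \<mu>) \<in> borel_measurable (borel \<Otimes>\<^sub>M borel)"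
    by (simp add: case_prod_beta')
  ultimately show ?thesis
    using mvn_pdf_mat_pos[OF s, where 'n='n] mvn_pdf_mat_le[OF s, where 'n='n] by (auto simp: regular_density_def)
qed

lemma integrable_mvn_mixture:
  assumes s: "0 < s" and L: "real_distribution L"
  shows "integrable L (\<lambda>v. mvn_pdf (mat s) (x :: real ^ 'n::finite) (\<theta> + v *\<^sub>R a))"
proof -
  interpret L: real_distribution L by fact
  note [measurable] = borel_measurable_mvn_pdf_mat[OF s]
  show ?thesis
    using mvn_pdf_mat_pos[OF s, where 'n='n] mvn_pdf_mat_le[OF s, where 'n='n]
    by (intro L.integrable_const_bound[of _ "1 / sqrt ((2 * pi * s) ^ CARD('n))"])
       (auto simp: abs_of_pos)
qed

lemma regular_density_mmn:
  fixes a :: "real ^ 'n::finite"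
  assumes s: "0 < s" and L: "real_distribution L"
  shows "regular_density (mmn_pdf a (mat s) L)"
proof -
  interpret L: real_distribution L by fact
  note [measurable] = borel_measurable_mvn_pdf_mat[OF s]
  interpret P: pair_sigma_finite L "lborel :: (real ^ 'n) measure" ..
  have eq: "ennreal (mmn_pdf a (mat s) L x \<theta>) = (\<integral>\<^sup>+v. ennreal (mvn_pdf (mat s) x (\<theta> + v *\<^sub>R a)) \<partial>L)" for x \<theta>
    unfolding mmn_pdf_def using mvn_pdf_mat_pos[OF s, where 'n='n]
    by (intro nn_integral_eq_integral[symmetric] integrable_mvn_mixture s L) (auto simp: less_imp_le)
  have "(\<integral>\<^sup>+x. ennreal (mmn_pdf a (mat s) L x \<theta>) \<partial>lborel) = 1" for \<theta>
  proof -
    have "(\<integral>\<^sup>+x. ennreal (mmn_pdf a (mat s) L x \<theta>) \<partial>lborel)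
        = (\<integral>\<^sup>+v. \<integral>\<^sup>+x. ennreal (mvn_pdf (mat s) x (\<theta> + v *\<^sub>R a)) \<partial>lborel \<partial>L)"
      unfolding eq by (rule P.Fubini') measurable
    then show ?thesis
      using L.emeasure_space_1 by (simp add: regular_density_prob[OF regular_density_mvn[OF s]])
  qed
  moreover have "mmn_pdf a (mat s) L x \<theta> \<le> 1 / sqrt ((2 * pi * s) ^ CARD('n))" for x \<theta>
    unfolding mmn_pdf_def using mvn_pdf_mat_le[OF s, where 'n='n]
    by (intro L.integral_le_const integrable_mvn_mixture s L) auto
  moreover have "0 < mmn_pdf a (mat s) L x \<theta>" for x \<theta>
    unfolding mmn_pdf_def using mvn_pdf_mat_pos[OF s, where 'n='n]
    by (intro L.expectation_greater integrable_mvn_mixture s L) auto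
  moreover have "(\<lambda>(x, \<theta>). mmn_pdf a (mat s) L x \<theta>) \<in> borel_measurable (borel \<Otimes>\<^sub>M borel)"
    unfolding mmn_pdf_def by measurable
  ultimately show ?thesis
    unfolding regular_density_def by blast
qed

lemma mvn_pdf_shift: "mvn_pdf \<Sigma> x \<mu> = mvn_pdf \<Sigma> (x - \<mu>) 0"
  by (simp add: mvn_pdf_def)

lemma mmn_pdf_shift: "mmn_pdf a \<Sigma> L x \<theta> = mmn_pdf a \<Sigma> L (x - \<theta>) 0"
  by (simp add: mmn_pdf_def mvn_pdf_def algebra_simps)

lemma location_model_mmn:
  assumes "0 < s" "0 < t" "real_distribution L\<^sub>1" "real_distribution L\<^sub>2"
  shows "location_model (\<lambda>x. mmn_pdf a (mat s) L\<^sub>1 x 0) (\<lambda>y. mmn_pdf a (mat t) L\<^sub>2 y 0)"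
proof -
  note reg = regular_density_mmn[OF assms(1,3), of a] regular_density_mmn[OF assms(2,4), of a]
  note [measurable] = reg[THEN regular_density_measurable_comp]
  show ?thesis
    by unfold_locales
       (use reg regular_density_bounded[OF reg(2)] in \<open>auto intro: less_imp_le regular_density_pos regular_density_prob\<close>)
qed

lemma minimax_mre_mmn:
  fixes a :: "real ^ 'n::finite"
  assumes "0 < s" "0 < t" "real_distribution L\<^sub>1" "real_distribution L\<^sub>2"
  defines "p \<equiv> mmn_pdf a (mat s) L\<^sub>1" and "q \<equiv> mmn_pdf a (mat t) L\<^sub>2"
  shows "minimax p q (mre_predictive p q)"
proof -
  interpret l: location_model "\<lambda>x. mmn_pdf a (mat s) L\<^sub>1 x 0" "\<lambda>y. mmn_pdf a (mat t) L\<^sub>2 y 0"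
    by (rule location_model_mmn[OF assms(1-4)])
  have eq: "l.p = p" "l.q = q"
    by (simp_all add: fun_eq_iff l.p_def l.q_def p_def q_def mmn_pdf_shift[symmetric])
  show ?thesis
    using l.minimax_mre unfolding eq by (simp add: p_def regular_density_mmn assms)
qed

lemma mmn_pdf_flat:
  assumes "0 < s" "real_distribution L"
  shows "(\<integral>\<^sup>+\<theta>. ennreal (mmn_pdf a (mat s) L x \<theta>) \<partial>lborel) = 1"
proof -
  note reg = regular_density_mmn[OF assms, of a]
  note [measurable] = regular_density_measurable_comp[OF reg]
  show ?thesis
    using nn_integral_lborel_reflect[of "\<lambda>z. ennreal (mmn_pdf a (mat s) L z 0)" x]
      regular_density_prob[OF reg, of 0]
    by (simp add: mmn_pdf_shift[of a _ _ x])
qed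

text \<open>
  The density depends on its arguments through norms of \<open>x - \<theta> - v a\<close> only.
\<close>

lemma mmn_pdf_orthogonal:
  fixes H :: "real ^ 'n ^ 'n::finite"
  assumes "0 < s" "orthogonal_transformation ((*v) H)"
  shows "mmn_pdf (H *v a) (mat s) L (H *v x) (H *v \<theta>) = mmn_pdf a (mat s) L x \<theta>"
proof -
  have "H *v x - (H *v \<theta> + v *\<^sub>R (H *v a)) = H *v (x - (\<theta> + v *\<^sub>R a))" for v
    by (simp add: matrix_vector_mult_diff_distrib matrix_vector_right_distrib matrix_vector_mult_scaleR)
  then show ?thesis
    using assms by (simp add: mmn_pdf_def mvn_pdf_mat orthogonal_transformation_norm)
qed

lemma norm_split_coords: "(norm z)\<^sup>2 = (norm (fst_coord z))\<^sup>2 + (norm (rest_coords z))\<^sup>2"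
  by (simp add: norm_vec_def L2_set_def fst_coord_def rest_coords_def UNIV_option_conv sum.reindex sum_nonneg)

lemma mvn_pdf_split_coords:
  fixes x \<mu> :: "real ^ 'm::finite option"
  assumes "0 < s"
  shows "mvn_pdf (mat s) x \<mu> = mvn_pdf (mat s) (fst_coord x) (fst_coord \<mu>) * mvn_pdf (mat s) (rest_coords x) (rest_coords \<mu>)"
proof -
  have "fst_coord (x - \<mu>) = fst_coord x - fst_coord \<mu>" "rest_coords (x - \<mu>) = rest_coords x - rest_coords \<mu>"
    by (simp_all add: fst_coord_def rest_coords_def vec_eq_iff)
  then have "(norm (x - \<mu>))\<^sup>2 = (norm (fst_coord x - fst_coord \<mu>))\<^sup>2 + (norm (rest_coords x - rest_coords \<mu>))\<^sup>2"
    by (simp add: norm_split_coords[of "x - \<mu>"])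
  then have "exp (- (norm (x - \<mu>))\<^sup>2 / (2 * s))
      = exp (- (norm (fst_coord x - fst_coord \<mu>))\<^sup>2 / (2 * s)) * exp (- (norm (rest_coords x - rest_coords \<mu>))\<^sup>2 / (2 * s))"
    by (simp add: exp_add[symmetric] diff_divide_distrib)
  then show ?thesis
    using assms by (simp add: mvn_pdf_mat card_option real_sqrt_mult)
qed

text \<open>
  The mixing variable moves the mean along \<open>b\<close>, hence not in the remaining coordinates: their
  normal density does not depend on it and comes out of the integral over \<open>L\<close>.
\<close>

lemma mmn_pdf_split_coords:
  fixes x \<theta> :: "real ^ 'm::finite option"
  assumes "0 < s" and b: "rest_coords b = 0"
  shows "mmn_pdf b (mat s) L x \<theta>
       = mmn_pdf (fst_coord b) (mat s) L (fst_coord x) (fst_coord \<theta>) * mvn_pdf (mat s) (rest_coords x) (rest_coords \<theta>)"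
proof -
  have "fst_coord (\<theta> + v *\<^sub>R b) = fst_coord \<theta> + v *\<^sub>R fst_coord b" for v
    by (simp add: fst_coord_def vec_eq_iff)
  moreover have "rest_coords (\<theta> + v *\<^sub>R b) = rest_coords \<theta> + v *\<^sub>R rest_coords b" for v
    by (simp add: rest_coords_def vec_eq_iff)
  ultimately show ?thesis
    using assms by (simp add: mmn_pdf_def mvn_pdf_split_coords)
qed

lemma mvn_pdf_eq_prod_normal_density:
  fixes x :: "real ^ 'n::finite"
  assumes "0 < s"
  shows "mvn_pdf (mat s) x 0 = (\<Prod>b\<in>Basis. normal_density 0 (sqrt s) (x \<bullet> b))"
proof -
  have "(\<Prod>b\<in>Basis. normal_density 0 (sqrt s) (x \<bullet> b))
      = (\<Prod>b\<in>(Basis::(real^'n) set). 1 / sqrt (2 * pi * s)) * exp (\<Sum>b\<in>Basis. - ((x \<bullet> b)\<^sup>2 / (2 * s)))"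
    using assms by (simp add: normal_density_def prod.distrib prod_dividef exp_sum power_one_over)
  also have "(\<Sum>b\<in>Basis. - ((x \<bullet> b)\<^sup>2 / (2 * s))) = - (norm x)\<^sup>2 / (2 * s)"
    unfolding power2_norm_eq_inner euclidean_inner[of x x]
    by (simp add: sum_negf sum_divide_distrib power2_eq_square)
  finally show ?thesis
    using assms by (simp add: mvn_pdf_mat power_divide real_sqrt_power)
qed

text \<open>
  Both densities are products over the coordinates, which reduces the convolution to
  dimension one.
\<close>

lemma mvn_pdf_convolution:
  fixes z :: "real ^ 'n::finite"
  assumes s: "0 < s" and t: "0 < t"
  shows "(\<integral>\<^sup>+w. ennreal (mvn_pdf (mat t) (z - w) 0 * mvn_pdf (mat s) w 0) \<partial>lborel) = ennreal (mvn_pdf (mat (s + t)) z 0)"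
proof -
  have st: "0 < s + t" using s t by simp
  have "(\<integral>\<^sup>+w. ennreal (mvn_pdf (mat t) (z - w) 0 * mvn_pdf (mat s) w 0) \<partial>lborel)
      = (\<integral>\<^sup>+w. (\<Prod>b\<in>Basis. (\<lambda>b w. ennreal (normal_density 0 (sqrt t) (z \<bullet> b - w) * normal_density 0 (sqrt s) w)) b (w \<bullet> b)) \<partial>lborel)"
    using s t by (simp add: mvn_pdf_eq_prod_normal_density prod.distrib[symmetric] prod_ennreal inner_diff_left)
  also have "\<dots> = (\<Prod>b\<in>Basis. \<integral>\<^sup>+w. ennreal (normal_density 0 (sqrt t) (z \<bullet> b - w) * normal_density 0 (sqrt s) w) \<partial>lborel)"
    by (rule nn_integral_lborel_prod) auto
  also have "\<dots> = (\<Prod>b\<in>Basis. ennreal (normal_density 0 (sqrt (s + t)) (z \<bullet> b)))"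
    using s t fun_cong[OF conv_normal_density_zero_mean[of "sqrt t" "sqrt s"]]
    by (simp add: add.commute)
  finally show ?thesis
    by (simp add: mvn_pdf_eq_prod_normal_density[OF st] prod_ennreal)
qed

lemma mre_predictive_mvn:
  assumes s: "0 < s" and t: "0 < t"
  shows "mre_predictive (mvn_pdf (mat s)) (mvn_pdf (mat t)) = mvn_pdf (mat (s + t) :: real ^ 'n::finite ^ 'n)"
proof (intro ext)
  fix y x :: "real ^ 'n"
  note reg = regular_density_mvn[OF s, where 'n='n] regular_density_mvn[OF t, where 'n='n]
  note [measurable] = borel_measurable_mvn_pdf_mat[OF s] borel_measurable_mvn_pdf_mat[OF t]
  have even: "mvn_pdf (mat s) (- w) 0 = mvn_pdf (mat s) (w :: real ^ 'n) 0" for w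
    using s by (simp add: mvn_pdf_mat)
  have shift: "mvn_pdf (mat u) z (x + w) = mvn_pdf (mat u) (z - x - w) 0" for u and z w :: "real ^ 'n"
    by (simp add: mvn_pdf_def algebra_simps)
  have "(\<integral>\<^sup>+\<theta>. ennreal (mvn_pdf (mat t) y \<theta> * (mvn_pdf (mat s) x \<theta> * 1)) \<partial>lborel)
      = (\<integral>\<^sup>+w. ennreal (mvn_pdf (mat t) y (x + w) * (mvn_pdf (mat s) x (x + w) * 1)) \<partial>lborel)"
    by (rule nn_integral_lborel_shift[symmetric]) measurable
  also have "\<dots> = ennreal (mvn_pdf (mat (s + t)) (y - x) 0)"
    using mvn_pdf_convolution[OF s t, of "y - x"] by (simp add: shift even)
  finally have num: "(\<integral>\<^sup>+\<theta>. ennreal (mvn_pdf (mat t) y \<theta> * (mvn_pdf (mat s) x \<theta> * 1)) \<partial>lborel)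
      = ennreal (mvn_pdf (mat (s + t)) y x)"
    by (simp add: mvn_pdf_shift[of _ y x])
  have "(\<integral>\<^sup>+\<theta>. ennreal (mvn_pdf (mat s) x \<theta> * 1) \<partial>lborel) = 1"
    using nn_integral_lborel_reflect[of "\<lambda>z. ennreal (mvn_pdf (mat s) z 0)" x]
      regular_density_prob[OF reg(1), of 0]
    by (simp add: mvn_pdf_shift[of _ x])
  then show "mre_predictive (mvn_pdf (mat s)) (mvn_pdf (mat t)) y x = mvn_pdf (mat (s + t)) y x"
    unfolding mre_predictive_def
    using bayes_predictive_eq_ratio[OF reg, of "\<lambda>_. 1" y x] num mvn_pdf_mat_pos[of "s + t" y x] s t
    by simp
qed

section \<open>The rotated mean-mixture model\<close>

lemma product_model_coords:
  fixes b :: "real ^ 'm::finite option"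
  assumes s: "0 < s" and t: "0 < t" and L: "real_distribution L\<^sub>1" "real_distribution L\<^sub>2"
    and b: "rest_coords b = 0"
  shows "product_model fst_coord rest_coords (mmn_pdf b (mat s) L\<^sub>1) (mmn_pdf b (mat t) L\<^sub>2)
      (mmn_pdf (fst_coord b) (mat s) L\<^sub>1) (mmn_pdf (fst_coord b) (mat t) L\<^sub>2)
      (mvn_pdf (mat s)) (mvn_pdf (mat t))"
proof
  show "\<exists>x. fst_coord x = u \<and> rest_coords x = v" for u :: "real ^ 1" and v :: "real ^ 'm"
    by (intro exI[of _ "\<chi> i. case i of None \<Rightarrow> u $ 1 | Some j \<Rightarrow> v $ j"])
       (simp add: fst_coord_def rest_coords_def vec_eq_iff)
qed (auto intro: nn_integral_split_coords regular_density_mmn regular_density_mvn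
       mmn_pdf_split_coords mmn_pdf_flat s t L b)

lemma distr_MMN_orthogonal:
  fixes H :: "real ^ 'n ^ 'n::finite"
  assumes s: "0 < s" and L: "real_distribution L" and H: "orthogonal_transformation ((*v) H)"
  shows "distr (MMN \<theta> a (mat s) L) borel ((*v) H) = MMN (H *v \<theta>) (H *v a) (mat s) L"
  unfolding MMN_eq_density[OF s L]
proof (rule measure_eqI)
  note [measurable] = regular_density_mmn[OF s L, THEN regular_density_measurable_comp]
  fix A assume "A \<in> sets (distr (density lborel (\<lambda>x. ennreal (mmn_pdf a (mat s) L x \<theta>))) borel ((*v) H))"
  then have A [measurable]: "A \<in> sets borel" by simp
  have "(*v) H -` A \<in> sets borel"
    using measurable_sets[OF matrix_vector_mult_measurable A, of H] by simp
  then have "emeasure (distr (density lborel (\<lambda>x. ennreal (mmn_pdf a (mat s) L x \<theta>))) borel ((*v) H)) A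
      = (\<integral>\<^sup>+x. ennreal (mmn_pdf (H *v a) (mat s) L (H *v x) (H *v \<theta>)) * indicator A (H *v x) \<partial>lborel)"
    by (simp add: emeasure_distr emeasure_density mmn_pdf_orthogonal[OF s H] indicator_def)
  also have "\<dots> = (\<integral>\<^sup>+z. ennreal (mmn_pdf (H *v a) (mat s) L z (H *v \<theta>)) * indicator A z \<partial>lborel)"
    by (rule nn_integral_lborel_orthogonal[OF H]) measurable
  finally show "emeasure (distr (density lborel (\<lambda>x. ennreal (mmn_pdf a (mat s) L x \<theta>))) borel ((*v) H)) A
      = emeasure (density lborel (\<lambda>x. ennreal (mmn_pdf (H *v a) (mat s) L x (H *v \<theta>)))) A"
    by (simp add: emeasure_density)
qed simp

lemma indep_with_laws_compose:
  assumes "indep_with_laws M X Y P Q" and [measurable]: "T \<in> borel_measurable borel"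
  shows "indep_with_laws M (\<lambda>\<omega>. T (X \<omega>)) (\<lambda>\<omega>. T (Y \<omega>)) (distr P borel T) (distr Q borel T)"
proof -
  have ps: "prob_space M" and ind: "prob_space.indep_var M borel X borel Y"
    and PQ: "distr M borel X = P" "distr M borel Y = Q"
    using assms(1) by (auto simp: indep_with_laws_def)
  interpret prob_space M by fact
  have rv [measurable]: "X \<in> borel_measurable M" "Y \<in> borel_measurable M"
    using indep_var_rv1[OF ind] indep_var_rv2[OF ind] by auto
  have "indep_var borel (T \<circ> X) borel (T \<circ> Y)"
    by (rule indep_var_compose[OF ind]) measurable
  then show ?thesis
    using ps by (simp add: indep_with_laws_def comp_def distr_distr PQ[symmetric])
qed

lemma orthogonal_first_row:
  fixes a :: "real ^ 'm::finite option"
  assumes a: "a \<noteq> 0" and H: "orthogonal_matrix H" "row None H = a /\<^sub>R norm a"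
  shows "H *v a = axis None (norm a)"
proof -
  have "transpose H *v axis None 1 = row None H"
    by (simp add: matrix_vector_mult_basis)
  then have "a = norm a *\<^sub>R (transpose H *v axis None 1)"
    using a H(2) by simp
  then have "H *v a = norm a *\<^sub>R (H *v (transpose H *v axis None 1))"
    by (metis matrix_vector_mult_scaleR)
  also have "H *v (transpose H *v axis None 1) = axis None 1"
    using H(1) unfolding matrix_vector_mul_assoc orthogonal_matrix_def by simp
  finally show ?thesis
    by (simp add: vec_eq_iff axis_def)
qed

theorem theorem5:
  fixes a :: "real ^ 'm::finite option"
    and \<sigma>\<^sub>X \<sigma>\<^sub>Y :: real
    and L\<^sub>1 L\<^sub>2 :: "real measure"
    and M :: "real ^ 'm option \<Rightarrow> 'w measure"
    and X Y :: "'w \<Rightarrow> real ^ 'm option"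
    and H :: "real ^ 'm option ^ 'm option"
    and \<pi>\<^sub>0 :: "real ^ 'm \<Rightarrow> real"
  assumes a: "a \<noteq> 0"
    and \<sigma>: "\<sigma>\<^sub>X > 0" "\<sigma>\<^sub>Y > 0"
    and L: "real_distribution L\<^sub>1" "real_distribution L\<^sub>2"
    and model: "\<And>\<theta>. indep_with_laws (M \<theta>) X Y
                       (MMN \<theta> a (mat (\<sigma>\<^sub>X\<^sup>2)) L\<^sub>1) (MMN \<theta> a (mat (\<sigma>\<^sub>Y\<^sup>2)) L\<^sub>2)"
    and H: "orthogonal_matrix H" "row None H = a /\<^sub>R norm a"
    and \<pi>\<^sub>0: "\<pi>\<^sub>0 \<in> borel_measurable borel" "\<And>z. 0 \<le> \<pi>\<^sub>0 z"
    and posterior: "posterior_well_defined (mmn_pdf a (mat (\<sigma>\<^sub>X\<^sup>2)) L\<^sub>1)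
                      (\<lambda>\<theta>. \<pi>\<^sub>0 (rest_coords (H *v \<theta>)))"
  shows
    "let p = mmn_pdf a (mat (\<sigma>\<^sub>X\<^sup>2)) L\<^sub>1;
         q = mmn_pdf a (mat (\<sigma>\<^sub>Y\<^sup>2)) L\<^sub>2;
         \<pi> = (\<lambda>\<theta>. \<pi>\<^sub>0 (rest_coords (H *v \<theta>)));
         p' = mmn_pdf (H *v a) (mat (\<sigma>\<^sub>X\<^sup>2)) L\<^sub>1;
         q' = mmn_pdf (H *v a) (mat (\<sigma>\<^sub>Y\<^sup>2)) L\<^sub>2;
         \<pi>' = (\<lambda>\<zeta>. \<pi>\<^sub>0 (rest_coords \<zeta>));
         p1 = mmn_pdf (vec (norm a) :: real ^ 1) (mat (\<sigma>\<^sub>X\<^sup>2)) L\<^sub>1;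
         q1 = mmn_pdf (vec (norm a) :: real ^ 1) (mat (\<sigma>\<^sub>Y\<^sup>2)) L\<^sub>2;
         p2 = mvn_pdf (mat (\<sigma>\<^sub>X\<^sup>2) :: real ^ 'm ^ 'm);
         q2 = mvn_pdf (mat (\<sigma>\<^sub>Y\<^sup>2) :: real ^ 'm ^ 'm)
     in
       \<comment> \<open>part (a): the transformed models\<close>
       (\<forall>\<theta>. indep_with_laws (M \<theta>) (\<lambda>\<omega>. H *v X \<omega>) (\<lambda>\<omega>. H *v Y \<omega>)
              (MMN (H *v \<theta>) (H *v a) (mat (\<sigma>\<^sub>X\<^sup>2)) L\<^sub>1)
              (MMN (H *v \<theta>) (H *v a) (mat (\<sigma>\<^sub>Y\<^sup>2)) L\<^sub>2)) \<and>
       (\<forall>\<theta>. indep_with_laws (M \<theta>)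
              (\<lambda>\<omega>. fst_coord (H *v X \<omega>)) (\<lambda>\<omega>. fst_coord (H *v Y \<omega>))
              (MMN (fst_coord (H *v \<theta>)) (vec (norm a)) (mat (\<sigma>\<^sub>X\<^sup>2)) L\<^sub>1)
              (MMN (fst_coord (H *v \<theta>)) (vec (norm a)) (mat (\<sigma>\<^sub>Y\<^sup>2)) L\<^sub>2)) \<and>
       (\<forall>\<theta>. indep_with_laws (M \<theta>)
              (\<lambda>\<omega>. rest_coords (H *v X \<omega>)) (\<lambda>\<omega>. rest_coords (H *v Y \<omega>))
              (mvn (rest_coords (H *v \<theta>)) (mat (\<sigma>\<^sub>X\<^sup>2)))
              (mvn (rest_coords (H *v \<theta>)) (mat (\<sigma>\<^sub>Y\<^sup>2)))) \<and>
       \<comment> \<open>part (a): the Bayes predictive densities\<close>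
       posterior_well_defined p' \<pi>' \<and>
       posterior_well_defined p2 \<pi>\<^sub>0 \<and>
       (\<forall>x y. bayes_predictive p q \<pi> y x = bayes_predictive p' q' \<pi>' (H *v y) (H *v x)) \<and>
       (\<forall>x' y'. bayes_predictive p' q' \<pi>' y' x' =
          mre_predictive p1 q1 (fst_coord y') (fst_coord x') *
          bayes_predictive p2 q2 \<pi>\<^sub>0 (rest_coords y') (rest_coords x')) \<and>
       \<comment> \<open>part (b)\<close>
       mre_predictive p2 q2 = mvn_pdf (mat (\<sigma>\<^sub>X\<^sup>2 + \<sigma>\<^sub>Y\<^sup>2)) \<and>
       (CARD('m option) \<ge> 4 \<longrightarrow>
          ((\<forall>\<theta>. kl_risk p q \<theta> (mre_predictive p q) < \<infinity>) \<longrightarrow>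
             (dominates p q (bayes_predictive p q \<pi>) (mre_predictive p q) \<longleftrightarrow>
              dominates p2 q2 (bayes_predictive p2 q2 \<pi>\<^sub>0) (mre_predictive p2 q2))) \<and>
          (dominates p q (bayes_predictive p q \<pi>) (mre_predictive p q) \<longrightarrow>
             dominates p2 q2 (bayes_predictive p2 q2 \<pi>\<^sub>0) (mre_predictive p2 q2) \<and>
             minimax p q (bayes_predictive p q \<pi>)))"
proof -
  define s t where "s = \<sigma>\<^sub>X\<^sup>2" and "t = \<sigma>\<^sub>Y\<^sup>2"
  define p q \<pi> where "p = mmn_pdf a (mat s) L\<^sub>1" and "q = mmn_pdf a (mat t) L\<^sub>2"
    and "\<pi> = (\<lambda>\<theta>. \<pi>\<^sub>0 (rest_coords (H *v \<theta>)))"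
  define p' q' \<pi>' where "p' = mmn_pdf (H *v a) (mat s) L\<^sub>1" and "q' = mmn_pdf (H *v a) (mat t) L\<^sub>2"
    and "\<pi>' = (\<lambda>\<zeta> :: real ^ 'm option. \<pi>\<^sub>0 (rest_coords \<zeta>))"
  define p1 q1 where "p1 = mmn_pdf (vec (norm a) :: real ^ 1) (mat s) L\<^sub>1"
    and "q1 = mmn_pdf (vec (norm a) :: real ^ 1) (mat t) L\<^sub>2"
  define p2 q2 where "p2 = mvn_pdf (mat s :: real ^ 'm ^ 'm)" and "q2 = mvn_pdf (mat t :: real ^ 'm ^ 'm)"
  note defs = p_def q_def \<pi>_def p'_def q'_def \<pi>'_def p1_def q1_def p2_def q2_def s_def t_def
  have s: "0 < s" and t: "0 < t"
    using \<sigma> by (simp_all add: s_def t_def)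
  have T: "orthogonal_transformation ((*v) H)"
    using H(1) by (simp add: orthogonal_transformation_matrix)
  have Ha: "fst_coord (H *v a) = vec (norm a)" "rest_coords (H *v a) = 0"
    unfolding orthogonal_first_row[OF a H] by (simp_all add: fst_coord_def rest_coords_def axis_def vec_eq_iff)
  have reg: "regular_density p" "regular_density q" "regular_density p1" "regular_density q1"
      "regular_density p2" "regular_density q2"
    unfolding defs(1-10) using s t L by (auto intro: regular_density_mmn regular_density_mvn)

  interpret rot: product_model fst_coord rest_coords p' q' p1 q1 p2 q2
    using product_model_coords[OF s t L Ha(2)] by (simp add: defs(1-10) Ha(1))
  interpret orig: product_model "\<lambda>x. fst_coord (H *v x)" "\<lambda>x. rest_coords (H *v x)" p q p1 q1 p2 q2
    by (rule rot.product_model_orthogonal[OF T matrix_vector_mult_measurable])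
       (use reg in \<open>auto simp: p_def q_def p'_def q'_def mmn_pdf_orthogonal[OF s T] mmn_pdf_orthogonal[OF t T]\<close>)
  \<comment> \<open>the roles of the two variables exchanged, for the marginal laws of \<open>Y\<close>\<close>
  interpret orig': product_model "\<lambda>x. fst_coord (H *v x)" "\<lambda>x. rest_coords (H *v x)" q p q1 p1 q2 p2
    by unfold_locales (use orig.c_surj orig.nn_integral_c reg orig.p_prod orig.q_prod
        mmn_pdf_flat[OF t L(2)] in \<open>auto simp: q1_def\<close>)

  have MMN: "MMN \<theta> a (mat s) L\<^sub>1 = density lborel (\<lambda>x. ennreal (p x \<theta>))"
      "MMN \<theta> a (mat t) L\<^sub>2 = density lborel (\<lambda>x. ennreal (q x \<theta>))" for \<theta>
    using MMN_eq_density[OF s L(1)] MMN_eq_density[OF t L(2)] by (simp_all add: p_def q_def)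
  have MMN1: "MMN \<theta> (vec (norm a)) (mat s) L\<^sub>1 = density lborel (\<lambda>x. ennreal (p1 x \<theta>))"
      "MMN \<theta> (vec (norm a)) (mat t) L\<^sub>2 = density lborel (\<lambda>x. ennreal (q1 x \<theta>))" for \<theta>
    using MMN_eq_density[OF s L(1)] MMN_eq_density[OF t L(2)] by (simp_all add: p1_def q1_def)
  have model': "indep_with_laws (M \<theta>) X Y (MMN \<theta> a (mat s) L\<^sub>1) (MMN \<theta> a (mat t) L\<^sub>2)" for \<theta>
    using model by (simp add: s_def t_def)

  have laws: "indep_with_laws (M \<theta>) (\<lambda>\<omega>. H *v X \<omega>) (\<lambda>\<omega>. H *v Y \<omega>)
      (MMN (H *v \<theta>) (H *v a) (mat s) L\<^sub>1) (MMN (H *v \<theta>) (H *v a) (mat t) L\<^sub>2)" for \<theta>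
    using indep_with_laws_compose[OF model' matrix_vector_mult_measurable, of \<theta> H]
    by (simp add: distr_MMN_orthogonal[OF s L(1) T] distr_MMN_orthogonal[OF t L(2) T])
  have laws1: "indep_with_laws (M \<theta>) (\<lambda>\<omega>. fst_coord (H *v X \<omega>)) (\<lambda>\<omega>. fst_coord (H *v Y \<omega>))
      (MMN (fst_coord (H *v \<theta>)) (vec (norm a)) (mat s) L\<^sub>1)
      (MMN (fst_coord (H *v \<theta>)) (vec (norm a)) (mat t) L\<^sub>2)" for \<theta>
    using indep_with_laws_compose[OF model' orig.c_measurable(1), of \<theta>]
    unfolding MMN MMN1 orig.distr_c\<^sub>1 orig'.distr_c\<^sub>1 .
  have laws2: "indep_with_laws (M \<theta>) (\<lambda>\<omega>. rest_coords (H *v X \<omega>)) (\<lambda>\<omega>. rest_coords (H *v Y \<omega>))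
      (mvn (rest_coords (H *v \<theta>)) (mat s)) (mvn (rest_coords (H *v \<theta>)) (mat t))" for \<theta>
    using indep_with_laws_compose[OF model' orig.c_measurable(2), of \<theta>]
    unfolding MMN mvn_def orig.distr_c\<^sub>2 orig'.distr_c\<^sub>2 p2_def q2_def .

  have wd: "posterior_well_defined p \<pi>"
    using posterior by (simp add: p_def \<pi>_def s_def)
  then have wd2: "posterior_well_defined p2 \<pi>\<^sub>0"
    using orig.posterior_well_defined_iff[OF \<pi>\<^sub>0] by (simp add: \<pi>_def)
  then have wd': "posterior_well_defined p' \<pi>'"
    using rot.posterior_well_defined_iff[OF \<pi>\<^sub>0] by (simp add: \<pi>'_def)

  have bayes: "bayes_predictive p q \<pi> y x
      = mre_predictive p1 q1 (fst_coord (H *v y)) (fst_coord (H *v x))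
        * bayes_predictive p2 q2 \<pi>\<^sub>0 (rest_coords (H *v y)) (rest_coords (H *v x))" for x y
    unfolding \<pi>_def by (rule orig.bayes_predictive_product[OF \<pi>\<^sub>0])
  have bayes': "bayes_predictive p' q' \<pi>' y x
      = mre_predictive p1 q1 (fst_coord y) (fst_coord x)
        * bayes_predictive p2 q2 \<pi>\<^sub>0 (rest_coords y) (rest_coords x)" for x y
    unfolding \<pi>'_def by (rule rot.bayes_predictive_product[OF \<pi>\<^sub>0])
  have mre: "mre_predictive p q y x
      = mre_predictive p1 q1 (fst_coord (H *v y)) (fst_coord (H *v x))
        * mre_predictive p2 q2 (rest_coords (H *v y)) (rest_coords (H *v x))" for x y
    using orig.bayes_predictive_product[of "\<lambda>_. 1"] by (simp add: mre_predictive_def)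
  have mre2: "mre_predictive p2 q2 = mvn_pdf (mat (s + t))"
    unfolding p2_def q2_def by (rule mre_predictive_mvn[OF s t])

  have [measurable]: "\<pi> \<in> borel_measurable borel"
    using \<pi>\<^sub>0(1) by (simp add: \<pi>_def)
  have mm: "minimax p q (mre_predictive p q)"
    unfolding p_def q_def by (rule minimax_mre_mmn[OF s t L])
  have "minimax p1 q1 (mre_predictive p1 q1)"
    unfolding p1_def q1_def by (rule minimax_mre_mmn[OF s t L])
  then have pd: "predictive_density (mre_predictive p q)" "predictive_density (mre_predictive p1 q1)"
      "predictive_density (bayes_predictive p q \<pi>)" "predictive_density (bayes_predictive p2 q2 \<pi>\<^sub>0)"
    using mm wd wd2 \<pi>\<^sub>0 reg by (auto simp: minimax_def \<pi>_def intro!: predictive_density_bayes)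
  have pd2: "predictive_density (mre_predictive p2 q2)"
    unfolding mre2 predictive_density_def using s t regular_density_mvn[of "s + t", where 'n='m]
    by (auto simp: regular_density_def less_imp_le)

  have iff: "dominates p q (bayes_predictive p q \<pi>) (mre_predictive p q)
      \<longleftrightarrow> dominates p2 q2 (bayes_predictive p2 q2 \<pi>\<^sub>0) (mre_predictive p2 q2)"
    if "kl_risk p q \<theta> (bayes_predictive p q \<pi>) < \<infinity> \<or> kl_risk p q \<theta> (mre_predictive p q) < \<infinity>" for \<theta>
    by (rule orig.dominates_iff[OF pd(2,4) pd2 pd(3) bayes pd(1) mre that])
  have fin: "\<exists>\<theta>. kl_risk p q \<theta> (bayes_predictive p q \<pi>) < \<infinity>"
    if "dominates p q (bayes_predictive p q \<pi>) (mre_predictive p q)"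
    using that unfolding dominates_def by (metis ereal_less_eq(1) order.strict_trans2)

  show ?thesis
    unfolding Let_def defs(1-10)[symmetric] s_def[symmetric] t_def[symmetric]
    using laws laws1 laws2 wd' wd2 bayes bayes' mre2 iff fin
      minimax_if_dominates_minimax[OF mm _ pd(3)] by metis
qed

end
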